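(* Let $C$ be the Cantor space and let $T\colon C\to C$ be a minimal homeomorphism. Then the topological full group $[[T]]$ is amenable (as a discrete group).
   Context: A Cantor system $(T,C)$ is a homeomorphism $T$ of the Cantor space $C$. It is called minimal if the only closed subsets $A\subseteq C$ with $T(A)=A$ are $\varnothing$ and $C$. The topological full group $[[T]]$ is the group (under composition) of all homeomorphisms $g$ of $C$ which are given piecewise by powers of $T$, each piece being open in $C$; that is, there is a finite partition of $C$ into open sets such that on each piece $U$ of the partition there is $k\in\mathbf{Z}$ with $g(q)=T^k(q)$ for all $q\in U$. A discrete group $G$ is amenable if it admits a left-invariant mean, i.e. a finitely additive probability measure defined on all subsets of $G$ and invariant under left translations. *)

theory Defs
  imports "HOL-Analysis.Analysis" "HOL-Algebra.Bij" "HOL-Algebra.Coset"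
begin

definition cantor_space :: "'a topology \<Rightarrow> bool" where
  "cantor_space X \<longleftrightarrow>
     X homeomorphic_space product_topology (\<lambda>_::nat. discrete_topology (UNIV :: bool set)) UNIV"

definition minimal_homeomorphism :: "'a topology \<Rightarrow> ('a \<Rightarrow> 'a) \<Rightarrow> bool" where
  "minimal_homeomorphism X T \<longleftrightarrow>
     homeomorphic_map X X T \<and>
     (\<forall>A. closedin X A \<and> T ` A = A \<longrightarrow> A = {} \<or> A = topspace X)"

text \<open>As in \<^const>\<open>BijGroup\<close>, self-maps of the space are represented by functions that are
  extensional on \<^term>\<open>topspace X\<close>, so that equality in the group is equality of maps
  on the space.\<close>

definition homeo_group :: "'a topology \<Rightarrow> ('a \<Rightarrow> 'a) monoid" where
  "homeo_group X =
     BijGroup (topspace X) \<lparr>carrier := {g \<in> extensional (topspace X). homeomorphic_map X X g}\<rparr>"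

text \<open>The powers of \<^term>\<open>T\<close> below are taken in the homeomorphism group, which requires passing
  to the extensional representative of \<^term>\<open>T\<close>.\<close>

definition topological_full_group :: "'a topology \<Rightarrow> ('a \<Rightarrow> 'a) \<Rightarrow> ('a \<Rightarrow> 'a) monoid" where
  "topological_full_group X T =
     homeo_group X \<lparr>carrier := {g \<in> carrier (homeo_group X).
       \<exists>P. finite P \<and> partition_on (topspace X) P \<and>
         (\<forall>U\<in>P. openin X U \<and>
           (\<exists>k::int. \<forall>q\<in>U. g q = (restrict T (topspace X) [^]\<^bsub>homeo_group X\<^esub> k) q))}\<rparr>"

definition left_invariant_mean :: "('g, 'm) monoid_scheme \<Rightarrow> ('g set \<Rightarrow> real) \<Rightarrow> bool" where
  "left_invariant_mean G \<mu> \<longleftrightarrow>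
     (\<forall>A. A \<subseteq> carrier G \<longrightarrow> 0 \<le> \<mu> A) \<and>
     \<mu> (carrier G) = 1 \<and>
     (\<forall>A B. A \<subseteq> carrier G \<and> B \<subseteq> carrier G \<and> A \<inter> B = {} \<longrightarrow> \<mu> (A \<union> B) = \<mu> A + \<mu> B) \<and>
     (\<forall>g A. g \<in> carrier G \<and> A \<subseteq> carrier G \<longrightarrow> \<mu> (g <#\<^bsub>G\<^esub> A) = \<mu> A)"

definition amenable_group :: "('g, 'm) monoid_scheme \<Rightarrow> bool" where
  "amenable_group G \<longleftrightarrow> group G \<and> (\<exists>\<mu>. left_invariant_mean G \<mu>)"

lemma homeo_group_subgroup:
  "subgroup {g \<in> extensional (topspace X). homeomorphic_map X X g} (BijGroup (topspace X))"
proof -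
  let ?S = "topspace X"
  let ?H = "{g \<in> extensional ?S. homeomorphic_map X X g}"
  have sub: "?H \<subseteq> Bij ?S"
    by (auto simp: Bij_def bij_betw_def dest: homeomorphic_imp_injective_map homeomorphic_imp_surjective_map)
  show ?thesis
  proof (rule subgroup.intro)
    show "?H \<subseteq> carrier (BijGroup ?S)"
      using sub by (simp add: BijGroup_def)
  next
    fix g f assume gf: "g \<in> ?H" "f \<in> ?H"
    then have "homeomorphic_map X X (g \<circ> f)"
      using homeomorphic_map_compose by blast
    then have "homeomorphic_map X X (compose ?S g f)"
      by (rule homeomorphic_map_eq) (simp add: compose_def)
    then show "g \<otimes>\<^bsub>BijGroup ?S\<^esub> f \<in> ?H"
      using gf sub by (auto simp: BijGroup_def)
  next
    have "homeomorphic_map X X (\<lambda>x\<in>?S. x)"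
      by (rule homeomorphic_map_eq[where f = id]) auto
    then show "\<one>\<^bsub>BijGroup ?S\<^esub> \<in> ?H"
      by (simp add: BijGroup_def)
  next
    fix g assume g: "g \<in> ?H"
    then obtain h where h: "homeomorphic_maps X X g h"
      by (auto simp: homeomorphic_map_maps)
    then have hh: "homeomorphic_map X X h"
      by (auto simp: homeomorphic_maps_map)
    have "h x = (\<lambda>x\<in>?S. inv_into ?S g x) x" if "x \<in> ?S" for x
    proof -
      have "h x \<in> ?S" "g (h x) = x"
        using h that by (auto simp: homeomorphic_maps_def continuous_map_def)
      moreover have "inj_on g ?S"
        using g by (auto simp: homeomorphic_map_def)
      ultimately show ?thesis
        using that inv_into_f_f[of g ?S "h x"] by simp
    qed
    then have "homeomorphic_map X X (\<lambda>x\<in>?S. inv_into ?S g x)"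
      by (rule homeomorphic_map_eq[OF hh])
    moreover have "inv\<^bsub>BijGroup ?S\<^esub> g = (\<lambda>x\<in>?S. inv_into ?S g x)"
      using g sub by (intro inv_BijGroup) auto
    ultimately show "inv\<^bsub>BijGroup ?S\<^esub> g \<in> ?H"
      by (metis (mono_tags, lifting) mem_Collect_eq restrict_extensional)
  qed
qed

lemma group_homeo_group: "group (homeo_group X)"
  unfolding homeo_group_def
  by (rule subgroup.subgroup_is_group[OF homeo_group_subgroup group_BijGroup])

lemma restrict_in_homeo_group:
  assumes "homeomorphic_map X X T"
  shows "restrict T (topspace X) \<in> carrier (homeo_group X)"
  using homeomorphic_map_eq[OF assms, of "restrict T (topspace X)"]
  by (simp add: homeo_group_def)

lemma mult_homeo_group:
  assumes "g \<in> carrier (homeo_group X)" "f \<in> carrier (homeo_group X)"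
  shows "g \<otimes>\<^bsub>homeo_group X\<^esub> f = compose (topspace X) g f"
  using assms subgroup.subset[OF homeo_group_subgroup[of X]]
  by (auto simp: homeo_group_def BijGroup_def)

end

theory Submission
  imports Defs
begin

text \<open>
  The full group of a minimal homeomorphism \<open>T\<close> acts faithfully on the orbit of a point, which is
  a copy of the integers, by permutations of bounded displacement (locale
  \<open>minimal_system\<close>). These permutations carry over to the collection \<open>X\<close> of all sets of integers
  that agree with the half-line of positive integers outside a finite set
  (\<open>eventually_halfline\<close>). Amenability results from two properties of the action on \<open>X\<close>.

  First, the action on \<open>X\<close> is amenable, and this holds for all permutations of bounded displacement
  (\<open>almost_invariant_on_eventual_halflines\<close>). Choose a random element of \<open>X\<close> by deciding
  independently for each integer whether it belongs to the set, with a probability that rises from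
  \<open>0\<close> to \<open>1\<close> along an interval of length \<open>n\<close>. If the probabilities are squares of sines of linearly
  increasing angles, then a permutation of bounded displacement changes about \<open>n\<close> angles by
  \<open>O(1 / n)\<close> each. The squared Hellinger distance between the old and the new distribution is of
  the order of the sum of the squared changes, which is \<open>O(1 / n)\<close> and tends to \<open>0\<close>.

  Second, stabilisers of points of \<open>X\<close> in the full group are locally finite
  (\<open>stabiliser_locally_finite\<close>); this is where minimality enters. Minimality and compactness make
  the local behaviour of finitely many elements near a point of the orbit recur with bounded gaps.
  So elements that preserve one set \<open>Y\<close> in \<open>X\<close> also preserve translates of it at
  positions with bounded gaps. These translates confine the orbits of the group that the elements
  generate to bounded intervals, on each of which the action is one of finitely many possibilities.

  Finally, an amenable action with locally finite stabilisers has an amenable acting group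
  (\<open>amenable_by_action\<close>): the almost invariant weights on \<open>X\<close> lift to the group by averaging over
  finite subsets of the stabilisers, and almost invariant means on the group accumulate at an
  invariant mean by compactness (\<open>amenable_if_almost_invariant_means\<close>).
\<close>

section \<open>Invariant means from almost invariant means\<close>

definition mean_on :: "'g set \<Rightarrow> ('g set \<Rightarrow> real) \<Rightarrow> bool" where
  "mean_on X \<mu> \<longleftrightarrow>
     (\<forall>A. A \<subseteq> X \<longrightarrow> 0 \<le> \<mu> A) \<and> \<mu> X = 1 \<and>
     (\<forall>A B. A \<subseteq> X \<and> B \<subseteq> X \<and> A \<inter> B = {} \<longrightarrow> \<mu> (A \<union> B) = \<mu> A + \<mu> B)"

lemma mean_on_le_1:
  assumes "mean_on X \<mu>" "A \<subseteq> X"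
  shows "\<mu> A \<le> 1"
proof -
  have "A \<union> (X - A) = X" "A \<inter> (X - A) = {}" "X - A \<subseteq> X" using assms by auto
  moreover from this have "\<mu> (A \<union> (X - A)) = \<mu> A + \<mu> (X - A)"
    using assms unfolding mean_on_def by blast
  moreover have "0 \<le> \<mu> (X - A)" "\<mu> X = 1"
    using assms unfolding mean_on_def by simp_all
  ultimately show ?thesis by simp
qed

lemma mean_on_restrict:
  assumes "mean_on X \<mu>"
  shows "mean_on X (\<lambda>A. \<mu> (A \<inter> X))"
  unfolding mean_on_def
proof (intro conjI allI impI)
  show "0 \<le> \<mu> (A \<inter> X)" for A
    using assms unfolding mean_on_def by simp
  show "\<mu> (X \<inter> X) = 1"
    using assms unfolding mean_on_def by simp
  fix A B assume "A \<subseteq> X \<and> B \<subseteq> X \<and> A \<inter> B = {}"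
  moreover from this have "A \<inter> X = A" "B \<inter> X = B" "(A \<union> B) \<inter> X = A \<union> B" by auto
  ultimately show "\<mu> ((A \<union> B) \<inter> X) = \<mu> (A \<inter> X) + \<mu> (B \<inter> X)"
    using assms unfolding mean_on_def by simp
qed

text \<open>Amenability is a compactness statement: means take values in the cube \<^term>\<open>{0..1::real}\<close> to the power
  of the power set, which is compact by Tychonoff's theorem.\<close>

lemma compact_unit_cube: "compact (PiE (UNIV :: 'i set) (\<lambda>_. {0..1::real}))"
proof -
  have "compactin (product_topology (\<lambda>_::'i. euclidean) UNIV) (PiE UNIV (\<lambda>_. {0..1::real}))"
    by (subst compactin_PiE) auto
  then show ?thesis
    by (simp add: euclidean_product_topology)
qed

text \<open>For each \<open>s\<close> and \<open>\<epsilon>\<close>, the means that \<open>s\<close> moves by at most \<open>\<epsilon>\<close> form a closed subset of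
  the compact cube, because every condition involves only finitely many coordinates. The
  hypothesis says that these sets have the finite intersection property, and a point of their
  intersection is an invariant mean.\<close>

lemma amenable_if_almost_invariant_means:
  fixes G (structure)
  assumes "group G"
    and almost: "\<And>S \<epsilon>. \<lbrakk>finite S; S \<subseteq> carrier G; \<epsilon> > 0\<rbrakk> \<Longrightarrow>
      \<exists>\<mu>. mean_on (carrier G) \<mu> \<and> (\<forall>s\<in>S. \<forall>A\<subseteq>carrier G. \<bar>\<mu> (s <#\<^bsub>G\<^esub> A) - \<mu> A\<bar> \<le> \<epsilon>)"
  shows "amenable_group G"
proof -
  interpret group G by fact
  define N where "N = (\<lambda>(s, \<epsilon>). {\<mu>. mean_on (carrier G) \<mu> \<and>
    (\<forall>A\<subseteq>carrier G. \<bar>\<mu> (s <#\<^bsub>G\<^esub> A) - \<mu> A\<bar> \<le> (\<epsilon>::real))})"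
  define I where "I = carrier G \<times> {0::real<..}"
  have coord: "continuous_on UNIV (\<lambda>\<mu>::'a set \<Rightarrow> real. \<mu> A)" for A
    by (rule continuous_on_product_coordinates)
  have "PiE UNIV (\<lambda>_. {0..1}) \<inter> (\<Inter>i\<in>I. N i) \<noteq> {}"
  proof (rule compact_imp_fip_image[OF compact_unit_cube])
    fix i assume "i \<in> I"
    obtain s \<epsilon> where i: "i = (s, \<epsilon>)" by force
    let ?G = "carrier G"
    have "N i = (\<Inter>A\<in>Pow ?G. {\<mu>. 0 \<le> \<mu> A}) \<inter> {\<mu>. \<mu> ?G = 1} \<inter>
      (\<Inter>(A, B)\<in>{(A, B). A \<subseteq> ?G \<and> B \<subseteq> ?G \<and> A \<inter> B = {}}. {\<mu>. \<mu> (A \<union> B) = \<mu> A + \<mu> B}) \<inter>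
      (\<Inter>A\<in>Pow ?G. {\<mu>. \<bar>\<mu> (s <#\<^bsub>G\<^esub> A) - \<mu> A\<bar> \<le> \<epsilon>})"
      unfolding N_def i mean_on_def by auto
    moreover have "closed \<dots>"
      by (intro closed_Int closed_INT ballI)
        (auto intro!: closed_Collect_le closed_Collect_eq continuous_on_add continuous_on_diff
          continuous_on_rabs continuous_on_const coord)
    ultimately show "closed (N i)" by simp
  next
    fix J assume J: "finite J" "J \<subseteq> I"
    define S where "S = fst ` J"
    define \<epsilon> where "\<epsilon> = Min (insert 1 (snd ` J))"
    have "\<epsilon> > 0" using J unfolding \<epsilon>_def I_def by auto
    moreover have "finite S" "S \<subseteq> carrier G" using J unfolding S_def I_def by auto
    ultimately obtain \<mu> where \<mu>: "mean_on (carrier G) \<mu>"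
      "\<And>s A. s \<in> S \<Longrightarrow> A \<subseteq> carrier G \<Longrightarrow> \<bar>\<mu> (s <#\<^bsub>G\<^esub> A) - \<mu> A\<bar> \<le> \<epsilon>"
      using almost by metis
    (* A mean is arbitrary on sets that are not subsets of the group; this one stays in the cube. *)
    define \<nu> where "\<nu> = (\<lambda>A. \<mu> (A \<inter> carrier G))"
    have "\<nu> A \<in> {0..1}" for A
      using mean_on_le_1[OF \<mu>(1), of "A \<inter> carrier G"] \<mu>(1) unfolding mean_on_def \<nu>_def by auto
    moreover have "\<nu> \<in> N (s, e)" if "(s, e) \<in> J" for s e
    proof -
      have s: "s \<in> S" "s \<in> carrier G" "\<epsilon> \<le> e"
        using that J unfolding S_def \<epsilon>_def I_def by (force intro: Min_le)+
      have "\<bar>\<nu> (s <#\<^bsub>G\<^esub> A) - \<nu> A\<bar> \<le> e" if "A \<subseteq> carrier G" for A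
        using \<mu>(2)[OF s(1) that] that s l_coset_subset_G[OF that s(2)]
        by (simp add: \<nu>_def inf.absorb1)
      then show ?thesis
        unfolding N_def using mean_on_restrict[OF \<mu>(1)] by (simp add: \<nu>_def)
    qed
    ultimately have "\<nu> \<in> PiE UNIV (\<lambda>_. {0..1}) \<inter> (\<Inter>i\<in>J. N i)" by auto
    then show "PiE UNIV (\<lambda>_. {0..1}) \<inter> (\<Inter>i\<in>J. N i) \<noteq> {}" by blast
  qed
  then obtain \<mu> where \<mu>: "\<And>s e. s \<in> carrier G \<Longrightarrow> e > 0 \<Longrightarrow> \<mu> \<in> N (s, e)"
    unfolding I_def by auto
  have mean: "mean_on (carrier G) \<mu>"
    using \<mu>[OF one_closed zero_less_one] unfolding N_def by auto
  have "\<mu> (s <#\<^bsub>G\<^esub> A) = \<mu> A" if "s \<in> carrier G" "A \<subseteq> carrier G" for s A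
  proof -
    have "\<bar>\<mu> (s <#\<^bsub>G\<^esub> A) - \<mu> A\<bar> \<le> 0 + e" if "e > 0" for e
      using \<mu>[OF \<open>s \<in> carrier G\<close> that] \<open>A \<subseteq> carrier G\<close> unfolding N_def by auto
    then have "\<bar>\<mu> (s <#\<^bsub>G\<^esub> A) - \<mu> A\<bar> \<le> 0"
      by (rule field_le_epsilon)
    then show ?thesis by simp
  qed
  with mean have "left_invariant_mean G \<mu>"
    unfolding left_invariant_mean_def mean_on_def by simp
  then show ?thesis
    unfolding amenable_group_def using \<open>group G\<close> by blast
qed

section \<open>Actions with locally finite stabilisers\<close>

text \<open>An amenable action with locally finite stabilisers forces amenability. The hypothesis
  \<open>stab\<close> is local finiteness in the weakest form that the argument uses: a nonempty finite set
  that the given stabiliser elements map into itself by left translation. The hypothesis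
  \<open>almost\<close> provides finitely supported weights on \<open>X\<close> that finitely many group elements
  move by little in \<open>L\<^sup>1\<close>; asking \<open>V\<close> to contain the supports of the moved weights as well
  lets every sum run over one finite set.

  To lift a weight \<open>f\<close> from \<open>X\<close> to \<open>G\<close>, choose a representative of every orbit and, for every
  point \<open>x\<close>, an element \<open>\<sigma> x\<close> carrying the representative to \<open>x\<close>. Replace the point mass at
  \<open>x\<close> by the uniform distribution on the translate by \<open>\<sigma> x\<close> of a finite subset \<open>K\<close> of the
  stabiliser of the representative. Moving \<open>x\<close> by \<open>s\<close> compares \<open>s \<otimes> \<sigma> x\<close> with \<open>\<sigma> (s x)\<close>, and
  the two differ by an element \<open>c s x\<close> of that stabiliser. Only finitely many of these elements
  occur, so \<open>K\<close> can be chosen invariant under all of them. Then the lifting commutes exactly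
  with \<open>s\<close>, and the lifted weight is as close to invariant as \<open>f\<close> is.\<close>

lemma amenable_by_action:
  fixes G (structure) and act :: "'g \<Rightarrow> 'x \<Rightarrow> 'x" and X :: "'x set"
  assumes "group G"
    and act_closed: "\<And>g x. \<lbrakk>g \<in> carrier G; x \<in> X\<rbrakk> \<Longrightarrow> act g x \<in> X"
    and act_one: "\<And>x. x \<in> X \<Longrightarrow> act \<one> x = x"
    and act_mult: "\<And>g h x. \<lbrakk>g \<in> carrier G; h \<in> carrier G; x \<in> X\<rbrakk> \<Longrightarrow> act (g \<otimes> h) x = act g (act h x)"
    and stab: "\<And>x S. \<lbrakk>x \<in> X; finite S; S \<subseteq> {g \<in> carrier G. act g x = x}\<rbrakk> \<Longrightarrow>
      \<exists>K. finite K \<and> K \<noteq> {} \<and> K \<subseteq> carrier G \<and> (\<forall>s\<in>S. \<forall>k\<in>K. s \<otimes> k \<in> K)"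
    and almost: "\<And>S \<epsilon>. \<lbrakk>finite S; S \<subseteq> carrier G; \<epsilon> > 0\<rbrakk> \<Longrightarrow>
      \<exists>V f. finite V \<and> V \<subseteq> X \<and> (\<forall>x. 0 \<le> f x) \<and> (\<Sum>x\<in>V. f x) = (1::real) \<and>
        (\<forall>x\<in>X. f x \<noteq> 0 \<longrightarrow> x \<in> V) \<and>
        (\<forall>s\<in>S. (\<forall>x\<in>X. f (act s x) \<noteq> 0 \<longrightarrow> x \<in> V) \<and> (\<Sum>x\<in>V. \<bar>f (act s x) - f x\<bar>) \<le> \<epsilon>)"
  shows "amenable_group G"
proof (rule amenable_if_almost_invariant_means[OF \<open>group G\<close>])
  interpret group G by fact
  fix S and \<epsilon> :: real assume S: "finite S" "S \<subseteq> carrier G" and \<epsilon>: "\<epsilon> > 0"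
  from almost[OF S \<epsilon>] obtain V f where V: "finite V" "V \<subseteq> X"
    and f0: "\<forall>x. 0 \<le> f x" and f1: "(\<Sum>x\<in>V. f x) = 1"
    and supp: "\<forall>x\<in>X. f x \<noteq> 0 \<longrightarrow> x \<in> V"
    and moved: "\<forall>s\<in>S. (\<forall>x\<in>X. f (act s x) \<noteq> 0 \<longrightarrow> x \<in> V) \<and>
      (\<Sum>x\<in>V. \<bar>f (act s x) - f x\<bar>) \<le> \<epsilon>"
    by (elim exE conjE) (rule that)
  have supp_s: "x \<in> V" if "s \<in> S" "x \<in> X" "f (act s x) \<noteq> 0" for s x
    using that moved by blast
  have near: "(\<Sum>x\<in>V. \<bar>f (act s x) - f x\<bar>) \<le> \<epsilon>" if "s \<in> S" for s
    using that moved by blast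
  have act_inv: "act (inv g) (act g x) = x" "act g (act (inv g) x) = x"
    if "g \<in> carrier G" "x \<in> X" for g x
    using that act_mult[of "inv g" g x] act_mult[of g "inv g" x] by (simp_all add: act_one)

  define orb where "orb x = (\<lambda>g. act g x) ` carrier G" for x
  have orb_act: "orb (act g x) = orb x" if g: "g \<in> carrier G" and x: "x \<in> X" for g x
  proof
    show "orb (act g x) \<subseteq> orb x"
    proof
      fix y assume "y \<in> orb (act g x)"
      then obtain h where h: "h \<in> carrier G" "y = act h (act g x)" unfolding orb_def by auto
      then have "y = act (h \<otimes> g) x" using act_mult g x by simp
      then show "y \<in> orb x" unfolding orb_def using h g by auto
    qed
    show "orb x \<subseteq> orb (act g x)"
    proof
      fix y assume "y \<in> orb x"
      then obtain h where h: "h \<in> carrier G" "y = act h x" unfolding orb_def by auto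
      then have "y = act (h \<otimes> inv g) (act g x)"
        using act_mult[of h "inv g" "act g x"] act_inv g x act_closed by simp
      then show "y \<in> orb (act g x)" unfolding orb_def using h g by auto
    qed
  qed
  define rep where "rep x = (SOME y. y \<in> orb x)" for x
  have rep_act: "rep (act g x) = rep x" if "g \<in> carrier G" "x \<in> X" for g x
    using orb_act[OF that] unfolding rep_def by simp
  have rep_orb: "rep x \<in> orb x" if "x \<in> X" for x
    unfolding rep_def by (rule someI[of _ x]) (use that act_one in \<open>force simp: orb_def\<close>)
  have rep_X: "rep x \<in> X" if "x \<in> X" for x
    using rep_orb[OF that] that act_closed unfolding orb_def by auto
  have "\<exists>g. g \<in> carrier G \<and> act g (rep x) = x" if x: "x \<in> X" for x
  proof -
    obtain h where h: "h \<in> carrier G" "rep x = act h x"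
      using rep_orb[OF x] unfolding orb_def by auto
    then have "act (inv h) (rep x) = x" using act_inv(1) x by simp
    then show ?thesis using h by blast
  qed
  then obtain \<sigma> where \<sigma>: "\<And>x. x \<in> X \<Longrightarrow> \<sigma> x \<in> carrier G" "\<And>x. x \<in> X \<Longrightarrow> act (\<sigma> x) (rep x) = x"
    by metis

  (* The discrepancy between s after sigma x and sigma of the moved point: it stabilises rep x. *)
  define c where "c s x = inv (\<sigma> (act s x)) \<otimes> (s \<otimes> \<sigma> x)" for s x
  have c_carrier: "c s x \<in> carrier G" if "s \<in> carrier G" "x \<in> X" for s x
    using that \<sigma> act_closed unfolding c_def by simp
  have c_stab: "act (c s x) (rep x) = rep x" if "s \<in> carrier G" "x \<in> X" for s x
  proof -
    have "act (c s x) (rep x) = act (inv (\<sigma> (act s x))) (act s x)"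
      using that \<sigma> act_closed rep_X unfolding c_def by (simp add: act_mult)
    also have "\<dots> = act (inv (\<sigma> (act s x))) (act (\<sigma> (act s x)) (rep (act s x)))"
      using that \<sigma>(2) act_closed by simp
    also have "\<dots> = rep x"
      using that act_inv(1) \<sigma>(1) rep_X rep_act act_closed by simp
    finally show ?thesis .
  qed
  have "\<exists>K. finite K \<and> K \<noteq> {} \<and> K \<subseteq> carrier G \<and>
      (\<forall>s\<in>S. \<forall>x\<in>V. rep x = y \<longrightarrow> (\<forall>k\<in>K. c s x \<otimes> k \<in> K))" if y: "y \<in> X" for y
  proof -
    have fin: "finite ((\<lambda>(s, x). c s x) ` (S \<times> {x \<in> V. rep x = y}))"
      using S V by simp
    have sub: "(\<lambda>(s, x). c s x) ` (S \<times> {x \<in> V. rep x = y}) \<subseteq> {g \<in> carrier G. act g y = y}"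
      using c_carrier[OF subsetD[OF S(2)] subsetD[OF V(2)]] c_stab[OF subsetD[OF S(2)] subsetD[OF V(2)]]
      by auto
    obtain K where "finite K" "K \<noteq> {}" "K \<subseteq> carrier G"
      "\<forall>h\<in>(\<lambda>(s, x). c s x) ` (S \<times> {x \<in> V. rep x = y}). \<forall>k\<in>K. h \<otimes> k \<in> K"
      using stab[OF y fin sub] by (elim exE conjE) (rule that)
    then show ?thesis by (intro exI[of _ K]) force
  qed
  then obtain K where K: "\<And>y. y \<in> X \<Longrightarrow> finite (K y)" "\<And>y. y \<in> X \<Longrightarrow> K y \<noteq> {}"
    "\<And>y. y \<in> X \<Longrightarrow> K y \<subseteq> carrier G"
    "\<And>s x k. \<lbrakk>s \<in> S; x \<in> V; k \<in> K (rep x)\<rbrakk> \<Longrightarrow> c s x \<otimes> k \<in> K (rep x)"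
    using rep_X V(2) by (metis subsetD)

  define \<beta> where "\<beta> x A = real (card {k \<in> K (rep x). \<sigma> x \<otimes> k \<in> A}) / real (card (K (rep x)))" for x A
  have \<beta>_mean: "mean_on (carrier G) (\<beta> x)" if "x \<in> X" for x
    unfolding mean_on_def
  proof (intro conjI allI impI)
    have fin: "finite (K (rep x))" "card (K (rep x)) > 0"
      using K rep_X[OF that] by (auto simp: card_gt_0_iff)
    show "0 \<le> \<beta> x A" for A unfolding \<beta>_def by simp
    have "{k \<in> K (rep x). \<sigma> x \<otimes> k \<in> carrier G} = K (rep x)"
      using K(3)[OF rep_X[OF that]] \<sigma>(1)[OF that] by auto
    then show "\<beta> x (carrier G) = 1"
      unfolding \<beta>_def using fin by (simp add: card_gt_0_iff)
    fix A B assume AB: "A \<subseteq> carrier G \<and> B \<subseteq> carrier G \<and> A \<inter> B = {}"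
    have "{k \<in> K (rep x). \<sigma> x \<otimes> k \<in> A \<union> B} =
      {k \<in> K (rep x). \<sigma> x \<otimes> k \<in> A} \<union> {k \<in> K (rep x). \<sigma> x \<otimes> k \<in> B}" by auto
    moreover have "{k \<in> K (rep x). \<sigma> x \<otimes> k \<in> A} \<inter> {k \<in> K (rep x). \<sigma> x \<otimes> k \<in> B} = {}"
      using AB by auto
    ultimately have "card {k \<in> K (rep x). \<sigma> x \<otimes> k \<in> A \<union> B} =
      card {k \<in> K (rep x). \<sigma> x \<otimes> k \<in> A} + card {k \<in> K (rep x). \<sigma> x \<otimes> k \<in> B}"
      using fin by (simp add: card_Un_disjoint)
    then show "\<beta> x (A \<union> B) = \<beta> x A + \<beta> x B"
      unfolding \<beta>_def by (simp add: add_divide_distrib)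
  qed
  have \<beta>_equiv: "\<beta> (act s x) (s <#\<^bsub>G\<^esub> A) = \<beta> x A" if s: "s \<in> S" and x: "x \<in> V" and A: "A \<subseteq> carrier G" for s x A
  proof -
    have sx: "s \<in> carrier G" "x \<in> X" "act s x \<in> X" using s x S V act_closed by auto
    let ?K = "K (rep x)"
    have KG: "?K \<subseteq> carrier G" "finite ?K" using K rep_X sx by auto
    have inj: "inj_on (\<lambda>k. c s x \<otimes> k) ?K"
      using KG(1) c_carrier[OF sx(1,2)] by (intro inj_onI) (metis Units_eq Units_l_cancel subsetD)
    (* An injective self-map of a finite set is onto, so inclusion already gives equality. *)
    have img: "(\<lambda>k. c s x \<otimes> k) ` ?K = ?K"
      using K(4)[OF s x] by (intro endo_inj_surj[OF KG(2) _ inj]) auto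
    have key: "\<sigma> (act s x) \<otimes> (c s x \<otimes> k) \<in> s <#\<^bsub>G\<^esub> A \<longleftrightarrow> \<sigma> x \<otimes> k \<in> A" if "k \<in> ?K" for k
    proof -
      have k: "k \<in> carrier G" using that KG by auto
      have "\<sigma> (act s x) \<otimes> (c s x \<otimes> k) = s \<otimes> (\<sigma> x \<otimes> k)"
        unfolding c_def using sx k \<sigma>(1) by (simp add: inv_solve_left m_assoc[symmetric])
      moreover have "s \<otimes> (\<sigma> x \<otimes> k) \<in> s <#\<^bsub>G\<^esub> A \<longleftrightarrow> \<sigma> x \<otimes> k \<in> A"
      proof -
        have "s \<otimes> a = s \<otimes> (\<sigma> x \<otimes> k) \<longleftrightarrow> a = \<sigma> x \<otimes> k" if "a \<in> A" for a
          using A sx k \<sigma>(1)[OF sx(2)] that by (intro Units_l_cancel) auto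
        then show ?thesis unfolding l_coset_def by force
      qed
      ultimately show ?thesis by simp
    qed
    have "{k \<in> ?K. \<sigma> (act s x) \<otimes> k \<in> s <#\<^bsub>G\<^esub> A} = (\<lambda>k. c s x \<otimes> k) ` {k \<in> ?K. \<sigma> x \<otimes> k \<in> A}"
    proof
      show "(\<lambda>k. c s x \<otimes> k) ` {k \<in> ?K. \<sigma> x \<otimes> k \<in> A} \<subseteq> {k \<in> ?K. \<sigma> (act s x) \<otimes> k \<in> s <#\<^bsub>G\<^esub> A}"
        using key img by blast
      show "{k \<in> ?K. \<sigma> (act s x) \<otimes> k \<in> s <#\<^bsub>G\<^esub> A} \<subseteq> (\<lambda>k. c s x \<otimes> k) ` {k \<in> ?K. \<sigma> x \<otimes> k \<in> A}"
      proof
        fix l assume l: "l \<in> {k \<in> ?K. \<sigma> (act s x) \<otimes> k \<in> s <#\<^bsub>G\<^esub> A}"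
        then obtain k where "k \<in> ?K" "l = c s x \<otimes> k" using img by blast
        then show "l \<in> (\<lambda>k. c s x \<otimes> k) ` {k \<in> ?K. \<sigma> x \<otimes> k \<in> A}" using key l by blast
      qed
    qed
    then have "card {k \<in> ?K. \<sigma> (act s x) \<otimes> k \<in> s <#\<^bsub>G\<^esub> A} = card {k \<in> ?K. \<sigma> x \<otimes> k \<in> A}"
      by (simp add: card_image inj_on_subset[OF inj])
    then show ?thesis
      unfolding \<beta>_def using rep_act[OF sx(1,2)] by simp
  qed

  define \<mu> where "\<mu> A = (\<Sum>x\<in>V. f x * \<beta> x A)" for A
  have "mean_on (carrier G) \<mu>"
    unfolding mean_on_def
  proof (intro conjI allI impI)
    show "0 \<le> \<mu> A" if "A \<subseteq> carrier G" for A
      unfolding \<mu>_def using f0 \<beta>_mean V that unfolding mean_on_def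
      by (intro sum_nonneg mult_nonneg_nonneg) auto
    have "\<beta> x (carrier G) = 1" if "x \<in> V" for x
      using \<beta>_mean[of x] V that unfolding mean_on_def by auto
    then show "\<mu> (carrier G) = 1" unfolding \<mu>_def using f1 by simp
    fix A B assume "A \<subseteq> carrier G \<and> B \<subseteq> carrier G \<and> A \<inter> B = {}"
    then have "\<beta> x (A \<union> B) = \<beta> x A + \<beta> x B" if "x \<in> V" for x
      using \<beta>_mean[of x] V that unfolding mean_on_def by blast
    then show "\<mu> (A \<union> B) = \<mu> A + \<mu> B"
      unfolding \<mu>_def by (simp add: distrib_left sum.distrib)
  qed
  moreover have "\<bar>\<mu> (s <#\<^bsub>G\<^esub> A) - \<mu> A\<bar> \<le> \<epsilon>" if s: "s \<in> S" and A: "A \<subseteq> carrier G" for s A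
  proof -
    have sG: "s \<in> carrier G" using s S by auto
    have "\<mu> (s <#\<^bsub>G\<^esub> A) = (\<Sum>y\<in>{y\<in>V. f y \<noteq> 0}. f y * \<beta> y (s <#\<^bsub>G\<^esub> A))"
      unfolding \<mu>_def by (rule sum.mono_neutral_right) (use V in auto)
    also have "\<dots> = (\<Sum>x\<in>{x\<in>V. f (act s x) \<noteq> 0}. f (act s x) * \<beta> x A)"
    proof (rule sum.reindex_bij_witness[of _ "act s" "act (inv s)"])
      fix y assume "y \<in> {y \<in> V. f y \<noteq> 0}"
      then have y: "y \<in> X" "f y \<noteq> 0" using V by auto
      then show *: "act s (act (inv s) y) = y" using act_inv(2) sG by simp
      have "act (inv s) y \<in> X" using y sG act_closed by simp
      then have V': "act (inv s) y \<in> V" using supp_s[OF s] y(2) * by simp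
      then show "act (inv s) y \<in> {x \<in> V. f (act s x) \<noteq> 0}" using y(2) * by simp
      show "f (act s (act (inv s) y)) * \<beta> (act (inv s) y) A = f y * \<beta> y (s <#\<^bsub>G\<^esub> A)"
        using \<beta>_equiv[OF s V' A] * by simp
    next
      fix x assume "x \<in> {x \<in> V. f (act s x) \<noteq> 0}"
      then have x: "x \<in> X" "f (act s x) \<noteq> 0" using V by auto
      then show "act (inv s) (act s x) = x" using act_inv(1) sG by simp
      show "act s x \<in> {y \<in> V. f y \<noteq> 0}" using supp x act_closed[OF sG x(1)] by simp
    qed
    also have "\<dots> = (\<Sum>x\<in>V. f (act s x) * \<beta> x A)"
      by (rule sum.mono_neutral_left) (use V in auto)
    finally have "\<mu> (s <#\<^bsub>G\<^esub> A) - \<mu> A = (\<Sum>x\<in>V. (f (act s x) - f x) * \<beta> x A)"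
      unfolding \<mu>_def by (simp add: sum_subtractf left_diff_distrib)
    also have "\<bar>\<dots>\<bar> \<le> (\<Sum>x\<in>V. \<bar>(f (act s x) - f x) * \<beta> x A\<bar>)"
      by (rule sum_abs)
    also have "\<dots> \<le> (\<Sum>x\<in>V. \<bar>f (act s x) - f x\<bar>)"
    proof (rule sum_mono)
      fix x assume "x \<in> V"
      then have "0 \<le> \<beta> x A" "\<beta> x A \<le> 1"
        using \<beta>_mean[of x] mean_on_le_1[of _ "\<beta> x" A] V A unfolding mean_on_def by auto
      then show "\<bar>(f (act s x) - f x) * \<beta> x A\<bar> \<le> \<bar>f (act s x) - f x\<bar>"
        by (simp add: abs_mult mult_left_le)
    qed
    also have "\<dots> \<le> \<epsilon>" by (rule near[OF s])
    finally show ?thesis .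
  qed
  ultimately show "\<exists>\<mu>. mean_on (carrier G) \<mu> \<and> (\<forall>s\<in>S. \<forall>A\<subseteq>carrier G. \<bar>\<mu> (s <#\<^bsub>G\<^esub> A) - \<mu> A\<bar> \<le> \<epsilon>)"
    by blast
qed


section \<open>Almost invariant random half-lines of integers\<close>

definition eventually_halfline :: "int set set" where
  "eventually_halfline = {Y. \<exists>m. (\<forall>j>m. j \<in> Y) \<and> (\<forall>j. j < - m \<longrightarrow> j \<notin> Y)}"

text \<open>A random subset of the integers is formed by putting the integers \<open>j\<close> into it independently,
  with probability \<open>(sin (\<theta> j))\<^sup>2\<close>. The angle \<open>\<theta>\<close> increases linearly from \<open>0\<close> at \<open>0\<close> to
  \<open>pi / 2\<close> at \<open>n\<close>, so the random set differs from the positive half-line only inside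
  \<open>{0..n}\<close>. A permutation of displacement at most \<open>k\<close> changes about \<open>n\<close> of these angles, each
  by \<open>O(k / n)\<close>. The Hellinger affinity of the two product distributions is the product of the
  cosines of the changes, hence at least \<open>1 - O(k\<^sup>2 / n)\<close>. The total variation distance of
  the individual factors is only \<open>O(k / n)\<close>, so summing it over the factors would not suffice;
  it is essential that the Hellinger distance is quadratic in the change of the angle.\<close>

definition halfline_outside :: "int set \<Rightarrow> int set set" where
  "halfline_outside J = {Y. \<forall>j. j \<notin> J \<longrightarrow> (j \<in> Y \<longleftrightarrow> 0 < j)}"

lemma sum_prod_halfline_outside:
  fixes a b :: "int \<Rightarrow> real"
  assumes "finite J"
  shows "(\<Sum>Y\<in>halfline_outside J. \<Prod>j\<in>J. if j \<in> Y then a j else b j) = (\<Prod>j\<in>J. a j + b j)"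
proof -
  have "(\<Sum>Y\<in>halfline_outside J. \<Prod>j\<in>J. if j \<in> Y then a j else b j) =
    (\<Sum>A\<in>Pow J. \<Prod>j\<in>J. if j \<in> A then a j else b j)"
  proof (rule sum.reindex_bij_witness[of _ "\<lambda>A. A \<union> {j. j \<notin> J \<and> 0 < j}" "\<lambda>Y. Y \<inter> J"])
    fix Y assume "Y \<in> halfline_outside J"
    then show "Y \<inter> J \<union> {j. j \<notin> J \<and> 0 < j} = Y" unfolding halfline_outside_def by auto
    show "Y \<inter> J \<in> Pow J" by simp
    show "(\<Prod>j\<in>J. if j \<in> Y \<inter> J then a j else b j) = (\<Prod>j\<in>J. if j \<in> Y then a j else b j)"
      by (rule prod.cong) auto
  next
    fix A assume "A \<in> Pow J"
    then show "(A \<union> {j. j \<notin> J \<and> 0 < j}) \<inter> J = A" by auto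
    show "A \<union> {j. j \<notin> J \<and> 0 < j} \<in> halfline_outside J"
      using \<open>A \<in> Pow J\<close> unfolding halfline_outside_def by auto
  qed
  also have "\<dots> = (\<Sum>A\<in>Pow J. prod a A * prod b (J - A))"
  proof (rule sum.cong[OF refl])
    fix A assume "A \<in> Pow J"
    then have "J \<inter> {j. j \<in> A} = A" "J \<inter> - {j. j \<in> A} = J - A" by auto
    then show "(\<Prod>j\<in>J. if j \<in> A then a j else b j) = prod a A * prod b (J - A)"
      using prod.If_cases[OF assms, of "\<lambda>j. j \<in> A" a b] by simp
  qed
  also have "\<dots> = (\<Prod>j\<in>J. a j + b j)"
    by (rule prod_add[OF assms, symmetric])
  finally show ?thesis .
qed

lemma finite_halfline_outside:
  assumes "finite J"
  shows "finite (halfline_outside J)"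
proof (rule finite_surj)
  show "finite (Pow J)" using assms by simp
  show "halfline_outside J \<subseteq> (\<lambda>A. A \<union> {j. j \<notin> J \<and> 0 < j}) ` Pow J"
  proof
    fix Y assume "Y \<in> halfline_outside J"
    then have "Y = Y \<inter> J \<union> {j. j \<notin> J \<and> 0 < j}" unfolding halfline_outside_def by auto
    then show "Y \<in> (\<lambda>A. A \<union> {j. j \<notin> J \<and> 0 < j}) ` Pow J" by blast
  qed
qed

definition ramp :: "nat \<Rightarrow> int \<Rightarrow> real" where
  "ramp n j = pi / 2 * max 0 (min 1 (real_of_int j / real n))"

lemma ramp_low: "j \<le> 0 \<Longrightarrow> ramp n j = 0"
  using divide_nonpos_nonneg[of "real_of_int j" "real n"] unfolding ramp_def by (simp add: max_def)

lemma ramp_high: "n > 0 \<Longrightarrow> j \<ge> int n \<Longrightarrow> ramp n j = pi / 2"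
  unfolding ramp_def by (simp add: field_simps max_def min_def)

lemma ramp_range: "ramp n j \<in> {0..pi / 2}"
proof -
  have "max 0 (min 1 (real_of_int j / real n)) \<in> {0..1}" by auto
  then show ?thesis unfolding ramp_def by auto
qed

lemma ramp_lipschitz: "\<bar>ramp n i - ramp n j\<bar> \<le> pi / 2 * (\<bar>real_of_int (i - j)\<bar> / real n)"
proof -
  have "\<bar>max 0 (min 1 x) - max 0 (min 1 y)\<bar> \<le> \<bar>x - y\<bar>" for x y :: real
    by (auto simp: max_def min_def)
  from this[of "real_of_int i / real n" "real_of_int j / real n"]
  have "\<bar>max 0 (min 1 (real_of_int i / real n)) - max 0 (min 1 (real_of_int j / real n))\<bar>
    \<le> \<bar>real_of_int (i - j)\<bar> / real n"
    by (simp add: diff_divide_distrib[symmetric] abs_divide)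
  then have "pi / 2 * \<bar>max 0 (min 1 (real_of_int i / real n)) - max 0 (min 1 (real_of_int j / real n))\<bar>
    \<le> pi / 2 * (\<bar>real_of_int (i - j)\<bar> / real n)"
    by (rule mult_left_mono) simp
  then show ?thesis
    unfolding ramp_def right_diff_distrib[symmetric] abs_mult by simp
qed

definition amplitude :: "nat \<Rightarrow> int set \<Rightarrow> int \<Rightarrow> real" where
  "amplitude n Y j = (if j \<in> Y then sin (ramp n j) else cos (ramp n j))"

text \<open>The square of this function is the probability of a set \<open>Y\<close>. Summing products of such
  functions is what produces Hellinger affinities.\<close>

definition product_amplitude :: "nat \<Rightarrow> int set \<Rightarrow> real" where
  "product_amplitude n Y = (if Y \<in> halfline_outside {0..int n} then \<Prod>j\<in>{0..int n}. amplitude n Y j else 0)"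

text \<open>The window of the product may be enlarged: at an integer outside \<open>{0..n}\<close> the angle is
  \<open>0\<close> or \<open>pi / 2\<close>, so the factor is \<open>1\<close> if \<open>Y\<close> agrees with the half-line there and \<open>0\<close>
  otherwise. This makes it possible to change variables along a permutation that does not
  preserve the window.\<close>

lemma product_amplitude_eq_prod:
  assumes "n > 0" and J: "finite J" "{0..int n} \<subseteq> J" and Y: "Y \<in> halfline_outside J"
  shows "product_amplitude n Y = (\<Prod>j\<in>J. amplitude n Y j)"
proof (cases "Y \<in> halfline_outside {0..int n}")
  case True
  have "amplitude n Y j = 1" if "j \<in> J - {0..int n}" for j
  proof (cases "j < 0")
    case True
    then show ?thesis
      using \<open>Y \<in> halfline_outside {0..int n}\<close> ramp_low[of j n]
      unfolding amplitude_def halfline_outside_def by auto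
  next
    case False
    then have *: "ramp n j = pi / 2" "j \<in> Y"
      using that \<open>Y \<in> halfline_outside {0..int n}\<close> ramp_high[OF \<open>n > 0\<close>, of j]
      unfolding halfline_outside_def by auto
    then show ?thesis unfolding amplitude_def * by simp
  qed
  then have "(\<Prod>j\<in>{0..int n}. amplitude n Y j) = (\<Prod>j\<in>J. amplitude n Y j)"
    using J by (intro prod.mono_neutral_left) auto
  with True show ?thesis unfolding product_amplitude_def by simp
next
  case False
  then obtain j where j: "j \<notin> {0..int n}" "(j \<in> Y) \<noteq> (0 < j)"
    unfolding halfline_outside_def by blast
  then have "amplitude n Y j = 0"
  proof (cases "j < 0")
    case True
    then show ?thesis using j ramp_low[of j n] unfolding amplitude_def by auto
  next
    case False
    then have *: "ramp n j = pi / 2" "j \<notin> Y"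
      using j ramp_high[OF \<open>n > 0\<close>, of j] by auto
    then show ?thesis unfolding amplitude_def * by simp
  qed
  moreover have "j \<in> J" using Y j unfolding halfline_outside_def by blast
  ultimately show ?thesis using False J unfolding product_amplitude_def by (simp add: prod_zero_iff) blast
qed

lemma one_minus_cos_le: "1 - cos x \<le> x\<^sup>2 / 2" for x :: real
proof -
  have "cos x = 1 - 2 * (sin (x / 2))\<^sup>2"
    using cos_double_sin[of "x / 2"] by simp
  moreover have "(sin (x / 2))\<^sup>2 \<le> (x / 2)\<^sup>2"
    using abs_sin_x_le_abs_x[of "x / 2"] abs_le_square_iff by blast
  ultimately show ?thesis by (simp add: power_divide)
qed

text \<open>Total variation is bounded by the Hellinger distance: factor the difference of squares and
  apply the Cauchy-Schwarz inequality.\<close>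

lemma sum_abs_diff_squares_le:
  fixes x y :: "'i \<Rightarrow> real"
  assumes x: "(\<Sum>i\<in>V. (x i)\<^sup>2) = 1" and y: "(\<Sum>i\<in>V. (y i)\<^sup>2) = 1" and c: "(\<Sum>i\<in>V. x i * y i) \<ge> 1 - c"
  shows "(\<Sum>i\<in>V. \<bar>(x i)\<^sup>2 - (y i)\<^sup>2\<bar>)\<^sup>2 \<le> 8 * c"
proof -
  let ?p = "\<Sum>i\<in>V. x i * y i"
  have minus: "(\<Sum>i\<in>V. \<bar>x i - y i\<bar>\<^sup>2) = 2 - 2 * ?p"
    using x y by (simp add: power2_diff sum.distrib sum_subtractf sum_distrib_left mult.assoc)
  have plus: "(\<Sum>i\<in>V. \<bar>x i + y i\<bar>\<^sup>2) = 2 + 2 * ?p"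
    using x y by (simp add: power2_sum sum.distrib sum_distrib_left mult.assoc)
  have nonneg: "0 \<le> 2 - 2 * ?p" "0 \<le> 2 + 2 * ?p"
    unfolding minus[symmetric] plus[symmetric] by (simp_all add: sum_nonneg)
  have "(\<Sum>i\<in>V. \<bar>(x i)\<^sup>2 - (y i)\<^sup>2\<bar>) = (\<Sum>i\<in>V. \<bar>x i - y i\<bar> * \<bar>x i + y i\<bar>)"
    by (simp add: abs_mult[symmetric] power2_eq_square algebra_simps)
  then have "(\<Sum>i\<in>V. \<bar>(x i)\<^sup>2 - (y i)\<^sup>2\<bar>)\<^sup>2 \<le> (2 - 2 * ?p) * (2 + 2 * ?p)"
    using Cauchy_Schwarz_ineq_sum[of "\<lambda>i. \<bar>x i - y i\<bar>" "\<lambda>i. \<bar>x i + y i\<bar>" V] minus plus by simp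
  also have "\<dots> \<le> (2 * c) * 4"
    using nonneg c by (intro mult_mono) auto
  finally show ?thesis by simp
qed

lemma almost_invariant_on_eventual_halflines:
  fixes k :: int and \<epsilon> :: real
  assumes "k \<ge> 0" "\<epsilon> > 0"
  shows "\<exists>V f. finite V \<and> V \<subseteq> eventually_halfline \<and> (\<forall>Y. 0 \<le> f Y) \<and> (\<Sum>Y\<in>V. f Y) = 1 \<and>
    (\<forall>Y. f Y \<noteq> 0 \<longrightarrow> Y \<in> V) \<and>
    (\<forall>s. bij s \<and> (\<forall>j. \<bar>s j - j\<bar> \<le> k) \<longrightarrow>
      (\<forall>Y. f (s ` Y) \<noteq> 0 \<longrightarrow> Y \<in> V) \<and> (\<Sum>Y\<in>V. \<bar>f (s ` Y) - f Y\<bar>) \<le> \<epsilon>)"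
proof -
  (* The first summand makes the final bound at most epsilon squared; the second absorbs the
     2 k + 1 integers by which the window J exceeds n, so that J has at most 2 n elements. *)
  define n where "n = nat \<lceil>2 * pi\<^sup>2 * (real_of_int k)\<^sup>2 / \<epsilon>\<^sup>2\<rceil> + nat (2 * k + 1)"
  have n: "n > 0" "real_of_int (2 * k + 1) \<le> real n" "2 * pi\<^sup>2 * (real_of_int k)\<^sup>2 / \<epsilon>\<^sup>2 \<le> real n"
    unfolding n_def using \<open>k \<ge> 0\<close> by (simp, linarith, linarith)
  (* A permutation of displacement at most k carries J to a set that contains {0..n}. *)
  define J where "J = {- k..int n + k}"
  define V where "V = halfline_outside J"
  define f where "f Y = (product_amplitude n Y)\<^sup>2" for Y
  have J: "finite J" "{0..int n} \<subseteq> J" "real (card J) = real n + real_of_int (2 * k + 1)"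
    unfolding J_def using \<open>k \<ge> 0\<close> by auto
  have product_amplitude_V: "product_amplitude n Y = (\<Prod>j\<in>J. if j \<in> Y then sin (ramp n j) else cos (ramp n j))"
    if "Y \<in> V" for Y
    using product_amplitude_eq_prod[OF n(1) J(1,2)] that unfolding V_def amplitude_def by simp
  have pyth: "(\<Sum>Y\<in>V. (\<Prod>j\<in>J. if j \<in> Y then sin (t j) else cos (t j))\<^sup>2) = 1" for t :: "int \<Rightarrow> real"
  proof -
    have "(\<Sum>Y\<in>V. (\<Prod>j\<in>J. if j \<in> Y then sin (t j) else cos (t j))\<^sup>2) =
      (\<Sum>Y\<in>V. \<Prod>j\<in>J. if j \<in> Y then (sin (t j))\<^sup>2 else (cos (t j))\<^sup>2)"
      unfolding prod_power_distrib by (intro sum.cong prod.cong refl) simp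
    also have "\<dots> = 1"
      unfolding V_def sum_prod_halfline_outside[OF J(1)] by simp
    finally show ?thesis .
  qed
  have supp: "Y \<in> V" if "f Y \<noteq> 0" for Y
  proof -
    have "Y \<in> halfline_outside {0..int n}"
      using that unfolding f_def product_amplitude_def by (auto split: if_splits)
    then show ?thesis using J(2) unfolding V_def halfline_outside_def by blast
  qed
  have supp_s: "Y \<in> V" if s: "bij s" "\<And>j. \<bar>s j - j\<bar> \<le> k" and "f (s ` Y) \<noteq> 0" for s Y
    unfolding V_def halfline_outside_def mem_Collect_eq
  proof (intro allI impI)
    fix j assume j: "j \<notin> J"
    have "s j \<notin> {0..int n}" "0 < s j \<longleftrightarrow> 0 < j"
      using j s(2)[of j] \<open>k \<ge> 0\<close> unfolding J_def by auto
    moreover have "s ` Y \<in> halfline_outside {0..int n}"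
      using that(3) unfolding f_def product_amplitude_def by (auto split: if_splits)
    ultimately have "s j \<in> s ` Y \<longleftrightarrow> 0 < j"
      unfolding halfline_outside_def by blast
    then show "j \<in> Y \<longleftrightarrow> 0 < j"
      using s(1) by (simp add: bij_is_inj inj_image_mem_iff)
  qed
  have move: "(\<Sum>Y\<in>V. \<bar>f (s ` Y) - f Y\<bar>) \<le> \<epsilon>" if s: "bij s" "\<And>j. \<bar>s j - j\<bar> \<le> k" for s
  proof -
    have product_amplitude_s: "product_amplitude n (s ` Y) = (\<Prod>j\<in>J. if j \<in> Y then sin (ramp n (s j)) else cos (ramp n (s j)))"
      if Y: "Y \<in> V" for Y
    proof -
      have "{0..int n} \<subseteq> s ` J"
      proof
        fix j assume j: "j \<in> {0..int n}"
        obtain i where "j = s i" using s(1) by (metis bij_pointE)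
        moreover from this have "i \<in> J" using s(2)[of i] j unfolding J_def by auto
        ultimately show "j \<in> s ` J" by blast
      qed
      moreover have "s ` Y \<in> halfline_outside (s ` J)"
        unfolding halfline_outside_def mem_Collect_eq
      proof (intro allI impI)
        fix j assume j: "j \<notin> s ` J"
        obtain i where i: "j = s i" using s(1) by (metis bij_pointE)
        then have "i \<notin> J" using j by blast
        then have "i \<in> Y \<longleftrightarrow> 0 < i" "0 < j \<longleftrightarrow> 0 < i"
          using Y s(2)[of i] i \<open>k \<ge> 0\<close> unfolding V_def halfline_outside_def J_def by auto
        then show "j \<in> s ` Y \<longleftrightarrow> 0 < j"
          using s(1) i by (simp add: bij_is_inj inj_image_mem_iff)
      qed
      ultimately have "product_amplitude n (s ` Y) = (\<Prod>j\<in>s ` J. amplitude n (s ` Y) j)"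
        using J(1) n(1) by (intro product_amplitude_eq_prod) auto
      also have "\<dots> = (\<Prod>j\<in>J. amplitude n (s ` Y) (s j))"
        using s(1) by (subst prod.reindex) (auto simp: bij_def intro: inj_on_subset)
      also have "\<dots> = (\<Prod>j\<in>J. if j \<in> Y then sin (ramp n (s j)) else cos (ramp n (s j)))"
        unfolding amplitude_def using s(1) by (simp add: bij_is_inj inj_image_mem_iff)
      finally show ?thesis .
    qed
    define \<delta> where "\<delta> = pi / 2 * (real_of_int k / real n)"
    have \<delta>: "\<bar>ramp n (s j) - ramp n j\<bar> \<le> \<delta>" for j
    proof -
      have "\<bar>ramp n (s j) - ramp n j\<bar> \<le> pi / 2 * (\<bar>real_of_int (s j - j)\<bar> / real n)"
        by (rule ramp_lipschitz)
      also have "\<dots> \<le> \<delta>"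
      proof -
        have "\<bar>real_of_int (s j - j)\<bar> \<le> real_of_int k"
          using s(2)[of j] by (metis of_int_abs of_int_le_iff)
        then show ?thesis
          unfolding \<delta>_def by (intro mult_left_mono divide_right_mono) auto
      qed
      finally show ?thesis .
    qed
    have cos_nonneg: "0 \<le> cos (ramp n (s j) - ramp n j)" for j
      using ramp_range[of n "s j"] ramp_range[of n j] by (intro cos_ge_zero) auto
    have small: "1 - cos (ramp n (s j) - ramp n j) \<le> \<delta>\<^sup>2 / 2" for j
    proof -
      have "(ramp n (s j) - ramp n j)\<^sup>2 \<le> \<delta>\<^sup>2"
        using \<delta>[of j] by (intro abs_le_square_iff[THEN iffD1]) linarith
      then show ?thesis using one_minus_cos_le[of "ramp n (s j) - ramp n j"] by linarith
    qed
    have "(\<Sum>Y\<in>V. product_amplitude n (s ` Y) * product_amplitude n Y) = (\<Prod>j\<in>J. cos (ramp n (s j) - ramp n j))"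
    proof -
      have "(\<Sum>Y\<in>V. product_amplitude n (s ` Y) * product_amplitude n Y) =
        (\<Sum>Y\<in>V. \<Prod>j\<in>J. if j \<in> Y then sin (ramp n (s j)) * sin (ramp n j) else cos (ramp n (s j)) * cos (ramp n j))"
        by (intro sum.cong refl) (simp add: product_amplitude_s product_amplitude_V prod.distrib[symmetric], intro prod.cong refl, simp)
      also have "\<dots> = (\<Prod>j\<in>J. cos (ramp n (s j) - ramp n j))"
        unfolding V_def sum_prod_halfline_outside[OF J(1)] by (intro prod.cong refl) (simp add: cos_diff)
      finally show ?thesis .
    qed
    also have "\<dots> = (\<Prod>j\<in>J. 1 - (1 - cos (ramp n (s j) - ramp n j)))" by simp
    also have "\<dots> \<ge> 1 - (\<Sum>j\<in>J. 1 - cos (ramp n (s j) - ramp n j))"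
      by (intro Weierstrass_prod_ineq) (use cos_nonneg in auto)
    finally have "(\<Sum>Y\<in>V. product_amplitude n (s ` Y) * product_amplitude n Y) \<ge> 1 - (\<Sum>j\<in>J. 1 - cos (ramp n (s j) - ramp n j))" .
    moreover have "(\<Sum>j\<in>J. 1 - cos (ramp n (s j) - ramp n j)) \<le> (\<Sum>j\<in>J. \<delta>\<^sup>2 / 2)"
      by (intro sum_mono small)
    ultimately have "(\<Sum>Y\<in>V. product_amplitude n (s ` Y) * product_amplitude n Y) \<ge> 1 - real (card J) * (\<delta>\<^sup>2 / 2)"
      by simp
    moreover have "(\<Sum>Y\<in>V. (product_amplitude n (s ` Y))\<^sup>2) = 1" "(\<Sum>Y\<in>V. (product_amplitude n Y)\<^sup>2) = 1"
      using pyth[of "\<lambda>j. ramp n (s j)"] pyth[of "ramp n"] by (simp_all add: product_amplitude_s product_amplitude_V cong: sum.cong)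
    ultimately have "(\<Sum>Y\<in>V. \<bar>f (s ` Y) - f Y\<bar>)\<^sup>2 \<le> 8 * (real (card J) * (\<delta>\<^sup>2 / 2))"
      unfolding f_def by (intro sum_abs_diff_squares_le)
    also have "\<dots> \<le> 8 * (2 * real n * (\<delta>\<^sup>2 / 2))"
      using n(2) J(3) by (intro mult_left_mono mult_right_mono) auto
    also have "\<dots> = 2 * pi\<^sup>2 * (real_of_int k)\<^sup>2 / real n"
      unfolding \<delta>_def using n(1) by (simp add: power2_eq_square field_simps)
    also have "\<dots> \<le> \<epsilon>\<^sup>2"
      using n \<open>\<epsilon> > 0\<close> by (simp add: field_simps)
    finally show ?thesis
      by (rule power2_le_imp_le) (use \<open>\<epsilon> > 0\<close> in simp)
  qed
  have "Y \<in> eventually_halfline" if "Y \<in> V" for Y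
    unfolding eventually_halfline_def mem_Collect_eq
    using that \<open>k \<ge> 0\<close> unfolding V_def halfline_outside_def J_def by (intro exI[of _ "int n + k"]) auto
  moreover have "finite V"
    unfolding V_def by (rule finite_halfline_outside[OF J(1)])
  moreover have "(\<Sum>Y\<in>V. f Y) = 1"
    unfolding f_def using pyth[of "ramp n"] by (simp add: product_amplitude_V cong: sum.cong)
  moreover have "\<forall>Y. 0 \<le> f Y" unfolding f_def by simp
  ultimately show ?thesis
    using supp supp_s move by (intro exI[of _ V] exI[of _ f]) blast
qed

section \<open>Recurrent permutations of the integers\<close>

text \<open>The abstract situation to which the topological full group is reduced. Recurrence says that
  whatever finitely many group elements do in a window around \<open>0\<close>, they also do, up to
  translation, in windows centred at a set of integers \<open>n\<close> with bounded gaps. Boundedness of the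
  displacement alone would not suffice, since the group of all permutations of the integers with
  bounded displacement contains free groups.\<close>

locale recurrent_displacement_action = group G for G (structure) +
  fixes \<phi> :: "'a \<Rightarrow> int \<Rightarrow> int"
  assumes act_one: "\<phi> \<one> j = j"
    and act_mult: "\<lbrakk>g \<in> carrier G; h \<in> carrier G\<rbrakk> \<Longrightarrow> \<phi> (g \<otimes> h) j = \<phi> g (\<phi> h j)"
    and faithful: "inj_on \<phi> (carrier G)"
    and displacement_bounded: "g \<in> carrier G \<Longrightarrow> \<exists>k. \<forall>j. \<bar>\<phi> g j - j\<bar> \<le> k"
    and recurrent: "\<lbrakk>finite S; S \<subseteq> carrier G\<rbrakk> \<Longrightarrow>
      \<exists>R. \<forall>j. \<exists>n. \<bar>n - j\<bar> \<le> R \<and> (\<forall>s\<in>S. \<forall>i. \<bar>i\<bar> \<le> L \<longrightarrow> \<phi> s (n + i) = n + \<phi> s i)"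
begin

lemma act_inv:
  assumes "g \<in> carrier G"
  shows "\<phi> (inv g) (\<phi> g j) = j" "\<phi> g (\<phi> (inv g) j) = j"
  using assms act_mult[of "inv g" g j] act_mult[of g "inv g" j] by (simp_all add: act_one)

lemma bij_act: "g \<in> carrier G \<Longrightarrow> bij (\<phi> g)"
  by (rule o_bij[of "\<phi> (inv g)"]) (auto simp: act_inv)

lemma displacement_bounded_on_finite:
  assumes "finite S" "S \<subseteq> carrier G"
  shows "\<exists>k\<ge>0. \<forall>s\<in>S. \<forall>j. \<bar>\<phi> s j - j\<bar> \<le> k"
proof -
  obtain b where b: "\<And>g j. g \<in> carrier G \<Longrightarrow> \<bar>\<phi> g j - j\<bar> \<le> b g"
    using displacement_bounded by metis
  define k where "k = Max (insert 0 (b ` S))"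
  have k: "k \<ge> 0" "\<And>s. s \<in> S \<Longrightarrow> b s \<le> k"
    using assms unfolding k_def by auto
  have "\<bar>\<phi> s j - j\<bar> \<le> k" if "s \<in> S" for s j
    using b[of s j] k(2)[OF that] that assms by force
  with k(1) show ?thesis by blast
qed

text \<open>Suppose that finitely many elements preserve a set \<open>Y\<close> that is a half-line up to finitely many
  points. Whether \<open>Y\<close> is preserved is decided near \<open>0\<close>, because points far from \<open>0\<close> cannot cross its
  boundary; hence, by recurrence, the elements also preserve the translates of \<open>Y\<close> by the
  recurrence times \<open>n\<close>. Every integer is caught between two such translates at bounded
  distance, so all products of the given elements have displacement at most a common bound \<open>D\<close>.
  The displacement of a product at \<open>j\<close> is then determined by the displacements of the given
  elements within distance \<open>D\<close> of \<open>j\<close>, and only finitely many such patterns exist. So only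
  finitely many products exist. The set \<open>K\<close> below is defined by these two invariants rather
  than as a generated submonoid, which avoids any induction over words.\<close>

lemma stabiliser_locally_finite:
  assumes "Y \<in> eventually_halfline" and S: "finite S" "S \<subseteq> carrier G"
    and stab: "\<And>s. s \<in> S \<Longrightarrow> \<phi> s ` Y = Y"
  shows "\<exists>K. finite K \<and> K \<noteq> {} \<and> K \<subseteq> carrier G \<and> (\<forall>s\<in>S. \<forall>g\<in>K. s \<otimes> g \<in> K)"
proof -
  obtain m0 where m0: "\<And>j. j > m0 \<Longrightarrow> j \<in> Y" "\<And>j. j < - m0 \<Longrightarrow> j \<notin> Y"
    using assms(1) unfolding eventually_halfline_def by blast
  define m where "m = max 0 m0"
  have m: "m \<ge> 0" "\<And>j. j > m \<Longrightarrow> j \<in> Y" "\<And>j. j < - m \<Longrightarrow> j \<notin> Y"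
    using m0 unfolding m_def by auto
  obtain k where k: "k \<ge> 0" "\<And>s j. s \<in> S \<Longrightarrow> \<bar>\<phi> s j - j\<bar> \<le> k"
    using displacement_bounded_on_finite[OF S] by metis
  (* Outside a window of this radius around n, the translate n + Y looks constant both at j and at
     the image of j; inside the window, recurrence applies. *)
  define L where "L = m + k"
  define good where "good n \<longleftrightarrow> (\<forall>s\<in>S. \<forall>i. \<bar>i\<bar> \<le> L \<longrightarrow> \<phi> s (n + i) = n + \<phi> s i)" for n
  obtain R where R: "\<And>j. \<exists>n. \<bar>n - j\<bar> \<le> R \<and> good n"
    using recurrent[OF S, of L] unfolding good_def by blast
  have stab_iff: "\<phi> s i \<in> Y \<longleftrightarrow> i \<in> Y" if "s \<in> S" for s i
    using stab[OF that] bij_act[of s] that S(2) by (metis bij_is_inj inj_image_mem_iff subsetD)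
  have translate: "\<phi> s j - n \<in> Y \<longleftrightarrow> j - n \<in> Y" if "good n" and s: "s \<in> S" for n s j
  proof -
    consider "\<bar>j - n\<bar> \<le> L" | "j - n > L" | "j - n < - L" by linarith
    then show ?thesis
    proof cases
      case 1
      then have "\<phi> s (n + (j - n)) = n + \<phi> s (j - n)"
        using \<open>good n\<close> s unfolding good_def by blast
      then show ?thesis using stab_iff[OF s, of "j - n"] by simp
    next
      case 2
      then have "j - n > m" "\<phi> s j - n > m" using k(1) k(2)[OF s, of j] unfolding L_def by linarith+
      then show ?thesis using m(2) by simp
    next
      case 3
      then have "j - n < - m" "\<phi> s j - n < - m" using k(1) k(2)[OF s, of j] unfolding L_def by linarith+
      then show ?thesis using m(3) by simp
    qed
  qed

  define preserves where
    "preserves g \<longleftrightarrow> (\<forall>n. good n \<longrightarrow> (\<forall>j. \<phi> g j - n \<in> Y \<longleftrightarrow> j - n \<in> Y))" for g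
  define D where "D = 2 * m + 2 * R + 1"
  have near: "\<bar>\<phi> g j - j\<bar> \<le> D" if "preserves g" for g j
  proof -
    (* The integer j lies in the translate n + Y but not in the translate n' + Y. *)
    obtain n where n: "\<bar>n - (j - m - R - 1)\<bar> \<le> R" "good n" using R by blast
    obtain n' where n': "\<bar>n' - (j + m + R + 1)\<bar> \<le> R" "good n'" using R by blast
    have "j - n \<in> Y" using n(1) by (intro m(2)) linarith
    moreover have "j - n' \<notin> Y" using n'(1) by (intro m(3)) linarith
    ultimately have "\<phi> g j - n \<in> Y" "\<phi> g j - n' \<notin> Y"
      using that n n' unfolding preserves_def by blast+
    then have "\<phi> g j - n \<ge> - m" "\<phi> g j - n' \<le> m" by (meson m not_le_imp_less)+
    then show ?thesis using n n' unfolding D_def by linarith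
  qed

  define pattern where "pattern j = (\<lambda>(s, i)\<in>S \<times> {- D..D}. \<phi> s (j + i) - (j + i))" for j
  have "range pattern \<subseteq> PiE (S \<times> {- D..D}) (\<lambda>_. {- k..k})"
  proof (rule image_subsetI)
    fix j
    have "\<phi> s j - j \<in> {- k..k}" if "s \<in> S" for s j
      using k(2)[OF that, of j] by (simp add: abs_le_iff)
    then show "pattern j \<in> PiE (S \<times> {- D..D}) (\<lambda>_. {- k..k})"
      unfolding pattern_def restrict_PiE_iff by (intro ballI, elim SigmaE) (simp only: prod.case)
  qed
  moreover have "finite (PiE (S \<times> {- D..D}) (\<lambda>_. {- k..k}))"
    using S by (intro finite_PiE) auto
  ultimately have fin_range: "finite (range pattern)" by (rule finite_subset)

  define K where "K = {g \<in> carrier G. preserves g \<and>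
    (\<forall>j j'. pattern j = pattern j' \<longrightarrow> \<phi> g j - j = \<phi> g j' - j')}"
  have K_carrier: "g \<in> carrier G" and K_preserves: "preserves g" if "g \<in> K" for g
    using that unfolding K_def by blast+
  have K_pattern: "\<phi> g j - j = \<phi> g j' - j'" if "g \<in> K" "pattern j = pattern j'" for g j j'
    using that unfolding K_def by blast
  have "finite K"
  proof -
    (* An element of K is determined by its displacement function, which factors through the
     finitely many patterns and takes values in a bounded interval. *)
    define \<delta> where "\<delta> g = (\<lambda>j. \<phi> g j - j)" for g
    have "\<delta> ` K \<subseteq> (\<lambda>w. w \<circ> pattern) ` PiE (range pattern) (\<lambda>_. {- D..D})"
    proof
      fix u assume "u \<in> \<delta> ` K"
      then obtain g where g: "g \<in> K" "u = \<delta> g" by blast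
      define w where "w = (\<lambda>v\<in>range pattern. u (inv_into UNIV pattern v))"
      have "w \<in> PiE (range pattern) (\<lambda>_. {- D..D})"
      proof -
        have "\<phi> g j - j \<in> {- D..D}" for j
          using near[OF K_preserves[OF g(1)], of j] by (simp add: abs_le_iff)
        then show ?thesis
          unfolding w_def g(2) \<delta>_def restrict_PiE_iff by blast
      qed
      moreover have "u j = w (pattern j)" for j
      proof -
        have "pattern (inv_into UNIV pattern (pattern j)) = pattern j"
          by (rule f_inv_into_f) simp
        then have "u (inv_into UNIV pattern (pattern j)) = u j"
          unfolding g(2) \<delta>_def by (rule K_pattern[OF g(1)])
        then show ?thesis unfolding w_def by simp
      qed
      ultimately show "u \<in> (\<lambda>w. w \<circ> pattern) ` PiE (range pattern) (\<lambda>_. {- D..D})"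
        by (intro image_eqI[of _ _ w]) auto
    qed
    moreover have "finite ((\<lambda>w. w \<circ> pattern) ` PiE (range pattern) (\<lambda>_. {- D..D}))"
      by (rule finite_imageI, rule finite_PiE[OF fin_range]) simp
    ultimately have "finite (\<delta> ` K)" by (rule finite_subset)
    moreover have "inj_on \<delta> K"
    proof (rule inj_onI)
      fix g h assume gh: "g \<in> K" "h \<in> K" "\<delta> g = \<delta> h"
      then have "\<phi> g j = \<phi> h j" for j
        using fun_cong[OF gh(3), of j] unfolding \<delta>_def by simp
      then show "g = h"
        using inj_onD[OF faithful] K_carrier gh(1,2) by blast
    qed
    ultimately show ?thesis by (rule finite_imageD)
  qed
  moreover have "\<one> \<in> K"
    unfolding K_def preserves_def by (simp add: act_one)
  moreover have "s \<otimes> g \<in> K" if s: "s \<in> S" and g: "g \<in> K" for s g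
  proof -
    have G: "s \<in> carrier G" "g \<in> carrier G" and pres: "preserves g"
      using s S K_carrier[OF g] K_preserves[OF g] by auto
    have "preserves (s \<otimes> g)"
      using pres translate[OF _ s] unfolding preserves_def by (simp add: act_mult[OF G])
    moreover have "\<phi> (s \<otimes> g) j - j = \<phi> (s \<otimes> g) j' - j'" if eq: "pattern j = pattern j'" for j j'
    proof -
      (* After g, both points sit at the same offset d inside windows with the same pattern. *)
      define d where "d = \<phi> g j - j"
      have d: "d = \<phi> g j' - j'" "d \<in> {- D..D}"
      proof -
        show "d = \<phi> g j' - j'" unfolding d_def by (rule K_pattern[OF g eq])
        have "\<bar>d\<bar> \<le> D" unfolding d_def by (rule near[OF pres])
        then show "d \<in> {- D..D}" by auto
      qed
      have "\<phi> s (j + d) - (j + d) = \<phi> s (j' + d) - (j' + d)"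
        using fun_cong[OF eq, of "(s, d)"] s d(2) unfolding pattern_def by simp
      moreover have "\<phi> g j = j + d" "\<phi> g j' = j' + d" using d(1) d_def by simp_all
      ultimately show ?thesis by (simp add: act_mult[OF G])
    qed
    ultimately show ?thesis using m_closed[OF G] unfolding K_def by blast
  qed
  ultimately show ?thesis using K_carrier by (intro exI[of _ K]) blast
qed


lemma act_eventually_halfline:
  assumes g: "g \<in> carrier G" and Y: "Y \<in> eventually_halfline"
  shows "\<phi> g ` Y \<in> eventually_halfline"
proof -
  obtain k where k: "\<And>j. \<bar>\<phi> g j - j\<bar> \<le> k" using displacement_bounded[OF g] by blast
  obtain m where m: "\<And>j. j > m \<Longrightarrow> j \<in> Y" "\<And>j. j < - m \<Longrightarrow> j \<notin> Y"
    using Y unfolding eventually_halfline_def by blast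
  have "j \<in> \<phi> g ` Y" if "j > m + k" for j
  proof -
    have "\<phi> (inv g) j \<in> Y"
      using k[of "\<phi> (inv g) j"] that act_inv(2)[OF g, of j] by (intro m(1)) linarith
    then show ?thesis using act_inv(2)[OF g, of j] by (metis imageI)
  qed
  moreover have "j \<notin> \<phi> g ` Y" if "j < - (m + k)" for j
  proof
    assume "j \<in> \<phi> g ` Y"
    then obtain i where i: "i \<in> Y" "j = \<phi> g i" by blast
    have "i < - m" using k[of i] i(2) that by linarith
    then show False using m(2) i(1) by blast
  qed
  ultimately show ?thesis unfolding eventually_halfline_def by blast
qed

theorem amenable: "amenable_group G"
proof (rule amenable_by_action[where act = "\<lambda>g Y. \<phi> g ` Y" and X = eventually_halfline])
  show "group G" by (rule is_group)
  show "\<phi> g ` Y \<in> eventually_halfline" if "g \<in> carrier G" "Y \<in> eventually_halfline" for g Y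
    using that by (rule act_eventually_halfline)
  show "\<phi> \<one> ` Y = Y" for Y by (simp add: act_one)
  show "\<phi> (g \<otimes> h) ` Y = \<phi> g ` \<phi> h ` Y" if "g \<in> carrier G" "h \<in> carrier G" for g h Y
    by (simp add: image_image act_mult[OF that])
  show "\<exists>K. finite K \<and> K \<noteq> {} \<and> K \<subseteq> carrier G \<and> (\<forall>s\<in>S. \<forall>k\<in>K. s \<otimes> k \<in> K)"
    if "Y \<in> eventually_halfline" "finite S" "S \<subseteq> {g \<in> carrier G. \<phi> g ` Y = Y}" for Y S
    using that by (intro stabiliser_locally_finite) auto
  fix S and \<epsilon> :: real assume S: "finite S" "S \<subseteq> carrier G" and "\<epsilon> > 0"
  obtain k where k: "k \<ge> 0" "\<forall>s\<in>S. \<forall>j. \<bar>\<phi> s j - j\<bar> \<le> k"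
    using displacement_bounded_on_finite[OF S] by blast
  have disp: "bij (\<phi> s) \<and> (\<forall>j. \<bar>\<phi> s j - j\<bar> \<le> k)" if "s \<in> S" for s
    using bij_act k(2) S(2) that by blast
  from almost_invariant_on_eventual_halflines[OF k(1) \<open>\<epsilon> > 0\<close>]
  obtain V f where V: "finite V" "V \<subseteq> eventually_halfline"
    and f: "\<forall>Y. 0 \<le> f Y" "(\<Sum>Y\<in>V. f Y) = (1::real)" "\<forall>Y. f Y \<noteq> 0 \<longrightarrow> Y \<in> V"
    and moved: "\<forall>s. bij s \<and> (\<forall>j. \<bar>s j - j\<bar> \<le> k) \<longrightarrow>
      (\<forall>Y. f (s ` Y) \<noteq> 0 \<longrightarrow> Y \<in> V) \<and> (\<Sum>Y\<in>V. \<bar>f (s ` Y) - f Y\<bar>) \<le> \<epsilon>"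
    by (elim exE conjE) (rule that)
  have "(\<forall>Y. f (\<phi> s ` Y) \<noteq> 0 \<longrightarrow> Y \<in> V) \<and> (\<Sum>Y\<in>V. \<bar>f (\<phi> s ` Y) - f Y\<bar>) \<le> \<epsilon>"
    if "s \<in> S" for s
    by (rule mp[OF spec[OF moved] disp[OF that]])
  with V f
  show "\<exists>V f. finite V \<and> V \<subseteq> eventually_halfline \<and> (\<forall>Y. 0 \<le> f Y) \<and> (\<Sum>Y\<in>V. f Y) = (1::real) \<and>
    (\<forall>Y\<in>eventually_halfline. f Y \<noteq> 0 \<longrightarrow> Y \<in> V) \<and>
    (\<forall>s\<in>S. (\<forall>Y\<in>eventually_halfline. f (\<phi> s ` Y) \<noteq> 0 \<longrightarrow> Y \<in> V) \<and>
      (\<Sum>Y\<in>V. \<bar>f (\<phi> s ` Y) - f Y\<bar>) \<le> \<epsilon>)"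
    by (intro exI[of _ V] exI[of _ f]) blast
qed

end

section \<open>Cocycles and the topological full group\<close>

lemma carrier_homeo_groupD:
  assumes "g \<in> carrier (homeo_group X)"
  shows "homeomorphic_map X X g" "g \<in> extensional (topspace X)"
  using assms by (simp_all add: homeo_group_def)

lemma homeo_group_mult_apply:
  assumes "g \<in> carrier (homeo_group X)" "h \<in> carrier (homeo_group X)" "q \<in> topspace X"
  shows "(g \<otimes>\<^bsub>homeo_group X\<^esub> h) q = g (h q)"
  using assms by (simp add: mult_homeo_group compose_eq)

lemma homeo_group_one_apply: "q \<in> topspace X \<Longrightarrow> \<one>\<^bsub>homeo_group X\<^esub> q = q"
  by (simp add: homeo_group_def BijGroup_def)

lemma homeo_group_apply_in:
  assumes "g \<in> carrier (homeo_group X)" "q \<in> topspace X"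
  shows "g q \<in> topspace X"
  using carrier_homeo_groupD(1)[OF assms(1)] assms(2)
  by (auto dest!: homeomorphic_imp_surjective_map)

lemma homeo_group_inv_apply:
  assumes "g \<in> carrier (homeo_group X)" "q \<in> topspace X"
  shows "g ((inv\<^bsub>homeo_group X\<^esub> g) q) = q" "(inv\<^bsub>homeo_group X\<^esub> g) (g q) = q"
proof -
  interpret H: group "homeo_group X" by (rule group_homeo_group)
  show "g ((inv\<^bsub>homeo_group X\<^esub> g) q) = q"
    using homeo_group_mult_apply[of g X "inv\<^bsub>homeo_group X\<^esub> g" q] assms
    by (simp add: homeo_group_one_apply)
  show "(inv\<^bsub>homeo_group X\<^esub> g) (g q) = q"
    using homeo_group_mult_apply[of "inv\<^bsub>homeo_group X\<^esub> g" X g q] assms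
    by (simp add: homeo_group_one_apply)
qed

definition iterate :: "'a topology \<Rightarrow> ('a \<Rightarrow> 'a) \<Rightarrow> int \<Rightarrow> 'a \<Rightarrow> 'a" where
  "iterate X T n = restrict T (topspace X) [^]\<^bsub>homeo_group X\<^esub> n"

locale homeo_system =
  fixes X :: "'a topology" and T :: "'a \<Rightarrow> 'a"
  assumes homeomorphic_T: "homeomorphic_map X X T"
begin

lemma iterate_carrier: "iterate X T n \<in> carrier (homeo_group X)"
  unfolding iterate_def
  by (intro group.int_pow_closed group_homeo_group restrict_in_homeo_group homeomorphic_T)

lemma iterate_in: "q \<in> topspace X \<Longrightarrow> iterate X T n q \<in> topspace X"
  by (rule homeo_group_apply_in[OF iterate_carrier])

lemma continuous_iterate: "continuous_map X X (iterate X T n)"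
  by (rule homeomorphic_imp_continuous_map[OF carrier_homeo_groupD(1)[OF iterate_carrier]])

lemma iterate_add:
  assumes "q \<in> topspace X"
  shows "iterate X T m (iterate X T n q) = iterate X T (m + n) q"
proof -
  have "iterate X T (m + n) = iterate X T m \<otimes>\<^bsub>homeo_group X\<^esub> iterate X T n"
    unfolding iterate_def
    by (intro group.int_pow_mult group_homeo_group restrict_in_homeo_group homeomorphic_T)
  then show ?thesis
    using homeo_group_mult_apply[OF iterate_carrier iterate_carrier assms] by simp
qed

lemma iterate_0: "q \<in> topspace X \<Longrightarrow> iterate X T 0 q = q"
  unfolding iterate_def by (simp add: homeo_group_one_apply)

lemma iterate_1:
  assumes "q \<in> topspace X"
  shows "iterate X T 1 q = T q"
proof -
  have "iterate X T 1 = restrict T (topspace X)"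
    unfolding iterate_def
    by (intro group.int_pow_1 group_homeo_group restrict_in_homeo_group homeomorphic_T)
  then show ?thesis using assms by simp
qed

lemma T_iterate:
  assumes "q \<in> topspace X"
  shows "T (iterate X T n q) = iterate X T (1 + n) q"
  using iterate_add[OF assms, of 1 n] iterate_1[OF iterate_in[OF assms]] by simp

text \<open>An element of the full group is a homeomorphism of the form \<open>q \<mapsto> T\<^bsup>\<kappa> q\<^esup> q\<close> with \<open>\<kappa>\<close> locally
  constant and of finite range. Describing elements by such functions instead of partitions
  makes products and inverses easy: the functions satisfy the chain rule of a cocycle.\<close>

definition cocycle :: "('a \<Rightarrow> 'a) \<Rightarrow> ('a \<Rightarrow> int) \<Rightarrow> bool" where
  "cocycle g \<kappa> \<longleftrightarrow> finite (\<kappa> ` topspace X) \<and> (\<forall>i. openin X {q \<in> topspace X. \<kappa> q = i}) \<and>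
     (\<forall>q\<in>topspace X. g q = iterate X T (\<kappa> q) q)"

lemma full_group_iff_cocycle:
  "g \<in> carrier (topological_full_group X T) \<longleftrightarrow> g \<in> carrier (homeo_group X) \<and> (\<exists>\<kappa>. cocycle g \<kappa>)"
proof -
  have "(\<exists>P. finite P \<and> partition_on (topspace X) P \<and>
      (\<forall>U\<in>P. openin X U \<and> (\<exists>k. \<forall>q\<in>U. g q = iterate X T k q))) \<longleftrightarrow> (\<exists>\<kappa>. cocycle g \<kappa>)"
    (is "?L \<longleftrightarrow> ?R")
  proof
    assume ?L
    then obtain P where P: "finite P" "partition_on (topspace X) P"
      and pieces: "\<forall>U\<in>P. openin X U \<and> (\<exists>k. \<forall>q\<in>U. g q = iterate X T k q)" by blast
    from pieces have "\<forall>U\<in>P. \<exists>k. \<forall>q\<in>U. g q = iterate X T k q" by blast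
    then obtain k where k: "\<forall>U\<in>P. \<forall>q\<in>U. g q = iterate X T (k U) q"
      using bchoice by metis
    define piece where "piece q = (SOME U. U \<in> P \<and> q \<in> U)" for q
    have piece_ex: "piece q \<in> P \<and> q \<in> piece q" if "q \<in> topspace X" for q
    proof -
      have "\<exists>U. U \<in> P \<and> q \<in> U" using that partition_onD1[OF P(2)] by blast
      then show ?thesis unfolding piece_def by (rule someI_ex)
    qed
    have piece_eq: "piece q = U" if "U \<in> P" "q \<in> U" for q U
    proof -
      have "q \<in> topspace X" using that partition_onD1[OF P(2)] by blast
      then show ?thesis
        using piece_ex[of q] that partition_onD2[OF P(2)] by (meson disjointD disjoint_iff)
    qed
    define \<kappa> where "\<kappa> q = k (piece q)" for q
    have "\<kappa> ` topspace X \<subseteq> k ` P" unfolding \<kappa>_def using piece_ex by blast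
    then have "finite (\<kappa> ` topspace X)" using P(1) by (meson finite_imageI finite_subset)
    moreover have "openin X {q \<in> topspace X. \<kappa> q = i}" for i
    proof -
      have "{q \<in> topspace X. \<kappa> q = i} = \<Union>{U \<in> P. k U = i}"
        using piece_ex piece_eq partition_onD1[OF P(2)] unfolding \<kappa>_def by (auto 4 3)
      then show ?thesis using pieces by auto
    qed
    moreover have "g q = iterate X T (\<kappa> q) q" if "q \<in> topspace X" for q
      using piece_ex[OF that] k unfolding \<kappa>_def by blast
    ultimately have "cocycle g \<kappa>" unfolding cocycle_def by blast
    then show ?R by blast
  next
    assume ?R
    then obtain \<kappa> where \<kappa>: "cocycle g \<kappa>" by blast
    define P where "P = (\<lambda>i. {q \<in> topspace X. \<kappa> q = i}) ` \<kappa> ` topspace X"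
    have "finite P" using \<kappa> unfolding P_def cocycle_def by blast
    moreover have "partition_on (topspace X) P"
      unfolding P_def by (rule partition_onI) (auto simp: disjnt_iff)
    moreover have "\<forall>U\<in>P. openin X U \<and> (\<exists>k. \<forall>q\<in>U. g q = iterate X T k q)"
      using \<kappa> unfolding P_def cocycle_def by force
    ultimately show ?L by blast
  qed
  then show ?thesis
    unfolding topological_full_group_def iterate_def by simp
qed

lemma cocycle_one: "cocycle \<one>\<^bsub>homeo_group X\<^esub> (\<lambda>_. 0)"
proof -
  have "openin X {q \<in> topspace X. (0::int) = i}" for i by (cases "i = 0") auto
  moreover have "finite ((\<lambda>_. 0::int) ` topspace X)"
    by (rule finite_subset[of _ "{0}"]) auto
  ultimately show ?thesis
    unfolding cocycle_def by (simp add: iterate_0 homeo_group_one_apply)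
qed

lemma cocycle_mult:
  assumes g: "g \<in> carrier (homeo_group X)" "cocycle g \<kappa>" and h: "h \<in> carrier (homeo_group X)" "cocycle h \<kappa>'"
  shows "cocycle (g \<otimes>\<^bsub>homeo_group X\<^esub> h) (\<lambda>q. \<kappa> (h q) + \<kappa>' q)"
  unfolding cocycle_def
proof (intro conjI allI ballI)
  have h_in: "h q \<in> topspace X" if "q \<in> topspace X" for q
    by (rule homeo_group_apply_in[OF h(1) that])
  have fin: "finite (\<kappa> ` topspace X)" "finite (\<kappa>' ` topspace X)"
    using g(2) h(2) unfolding cocycle_def by blast+
  have "(\<lambda>q. \<kappa> (h q) + \<kappa>' q) ` topspace X \<subseteq> (\<lambda>(a, b). a + b) ` (\<kappa> ` topspace X \<times> \<kappa>' ` topspace X)"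
    using h_in by force
  then show "finite ((\<lambda>q. \<kappa> (h q) + \<kappa>' q) ` topspace X)"
    by (rule finite_subset) (intro finite_imageI finite_cartesian_product fin)
  fix i
  have "openin X {q \<in> topspace X. h q \<in> {r \<in> topspace X. \<kappa> r = i - a}}" for a
    using g(2) unfolding cocycle_def
    by (intro openin_continuous_map_preimage[of X X] homeomorphic_imp_continuous_map
        carrier_homeo_groupD(1)[OF h(1)]) blast
  moreover have "openin X {q \<in> topspace X. \<kappa>' q = a}" for a
    using h(2) unfolding cocycle_def by blast
  ultimately have "openin X (\<Union>a. {q \<in> topspace X. h q \<in> {r \<in> topspace X. \<kappa> r = i - a}} \<inter>
      {q \<in> topspace X. \<kappa>' q = a})"
    by (intro openin_Union openin_Int) auto
  moreover have "(\<Union>a. {q \<in> topspace X. h q \<in> {r \<in> topspace X. \<kappa> r = i - a}} \<inter>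
      {q \<in> topspace X. \<kappa>' q = a}) = {q \<in> topspace X. \<kappa> (h q) + \<kappa>' q = i}"
    using h_in by auto
  ultimately show "openin X {q \<in> topspace X. \<kappa> (h q) + \<kappa>' q = i}" by simp
next
  fix q assume q: "q \<in> topspace X"
  have "(g \<otimes>\<^bsub>homeo_group X\<^esub> h) q = g (h q)"
    by (rule homeo_group_mult_apply[OF g(1) h(1) q])
  also have "\<dots> = iterate X T (\<kappa> (h q)) (h q)"
    using g(2) homeo_group_apply_in[OF h(1) q] unfolding cocycle_def by blast
  also have "h q = iterate X T (\<kappa>' q) q"
    using h(2) q unfolding cocycle_def by blast
  finally show "(g \<otimes>\<^bsub>homeo_group X\<^esub> h) q = iterate X T (\<kappa> (h q) + \<kappa>' q) q"
    using iterate_add[OF q] \<open>h q = iterate X T (\<kappa>' q) q\<close> by simp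
qed

lemma cocycle_inv:
  assumes g: "g \<in> carrier (homeo_group X)" "cocycle g \<kappa>"
  shows "cocycle (inv\<^bsub>homeo_group X\<^esub> g) (\<lambda>q. - \<kappa> ((inv\<^bsub>homeo_group X\<^esub> g) q))"
  unfolding cocycle_def
proof (intro conjI allI ballI)
  let ?h = "inv\<^bsub>homeo_group X\<^esub> g"
  have h: "?h \<in> carrier (homeo_group X)"
    using g(1) by (rule group.inv_closed[OF group_homeo_group])
  have h_in: "?h q \<in> topspace X" if "q \<in> topspace X" for q
    by (rule homeo_group_apply_in[OF h that])
  have "finite (\<kappa> ` topspace X)" using g(2) unfolding cocycle_def by blast
  moreover have "(\<lambda>q. - \<kappa> (?h q)) ` topspace X \<subseteq> uminus ` \<kappa> ` topspace X" using h_in by blast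
  ultimately show "finite ((\<lambda>q. - \<kappa> (?h q)) ` topspace X)"
    by (meson finite_imageI finite_subset)
  fix i
  have "openin X {q \<in> topspace X. ?h q \<in> {r \<in> topspace X. \<kappa> r = - i}}"
    using g(2) unfolding cocycle_def
    by (intro openin_continuous_map_preimage[of X X] homeomorphic_imp_continuous_map
        carrier_homeo_groupD(1)[OF h]) blast
  moreover have "{q \<in> topspace X. ?h q \<in> {r \<in> topspace X. \<kappa> r = - i}} = {q \<in> topspace X. - \<kappa> (?h q) = i}"
    using h_in by auto
  ultimately show "openin X {q \<in> topspace X. - \<kappa> (?h q) = i}" by simp
next
  let ?h = "inv\<^bsub>homeo_group X\<^esub> g"
  fix q assume q: "q \<in> topspace X"
  have h: "?h q \<in> topspace X"
    by (rule homeo_group_apply_in[OF group.inv_closed[OF group_homeo_group g(1)] q])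
  have "g (?h q) = iterate X T (\<kappa> (?h q)) (?h q)"
    using g(2) h unfolding cocycle_def by blast
  then have eq: "iterate X T (\<kappa> (?h q)) (?h q) = q"
    using homeo_group_inv_apply(1)[OF g(1) q] by simp
  have "iterate X T (- \<kappa> (?h q)) (iterate X T (\<kappa> (?h q)) (?h q)) = ?h q"
    using iterate_add[OF h] iterate_0[OF h] by simp
  then show "?h q = iterate X T (- \<kappa> (?h q)) q" by (simp only: eq)
qed

lemma subgroup_full_group: "subgroup (carrier (topological_full_group X T)) (homeo_group X)"
proof (rule subgroup.intro)
  interpret H: group "homeo_group X" by (rule group_homeo_group)
  show "carrier (topological_full_group X T) \<subseteq> carrier (homeo_group X)"
    using full_group_iff_cocycle by blast
  show "g \<otimes>\<^bsub>homeo_group X\<^esub> h \<in> carrier (topological_full_group X T)"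
    if "g \<in> carrier (topological_full_group X T)" "h \<in> carrier (topological_full_group X T)" for g h
    using that cocycle_mult H.m_closed unfolding full_group_iff_cocycle by blast
  show "\<one>\<^bsub>homeo_group X\<^esub> \<in> carrier (topological_full_group X T)"
    using cocycle_one H.one_closed unfolding full_group_iff_cocycle by blast
  show "inv\<^bsub>homeo_group X\<^esub> g \<in> carrier (topological_full_group X T)"
    if "g \<in> carrier (topological_full_group X T)" for g
    using that cocycle_inv H.inv_closed unfolding full_group_iff_cocycle by blast
qed

lemma full_group_record:
  "topological_full_group X T = homeo_group X\<lparr>carrier := carrier (topological_full_group X T)\<rparr>"
  unfolding topological_full_group_def by simp

lemma group_full_group: "group (topological_full_group X T)"
  by (subst full_group_record)
    (rule subgroup.subgroup_is_group[OF subgroup_full_group group_homeo_group])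

lemma full_group_mult: "x \<otimes>\<^bsub>topological_full_group X T\<^esub> y = x \<otimes>\<^bsub>homeo_group X\<^esub> y"
  by (subst full_group_record) simp

lemma full_group_one: "\<one>\<^bsub>topological_full_group X T\<^esub> = \<one>\<^bsub>homeo_group X\<^esub>"
  by (subst full_group_record) simp

end

section \<open>The action on an orbit of a minimal homeomorphism\<close>

text \<open>Infinity of the space rules out periodic points (\<open>inj_orbit\<close>). The base point \<open>p\<close>
  selects the orbit that is identified with the integers.\<close>

locale minimal_system = homeo_system +
  fixes p
  assumes compact: "compact_space X" and Hausdorff: "Hausdorff_space X"
    and infinite_space: "infinite (topspace X)"
    and minimal: "\<lbrakk>closedin X A; T ` A = A\<rbrakk> \<Longrightarrow> A = {} \<or> A = topspace X"
    and base: "p \<in> topspace X"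
begin

text \<open>The closure of an orbit is closed and invariant.\<close>

lemma dense_orbit:
  assumes q: "q \<in> topspace X"
  shows "X closure_of range (\<lambda>n. iterate X T n q) = topspace X"
proof -
  let ?O = "range (\<lambda>n. iterate X T n q)"
  have sub: "?O \<subseteq> topspace X" using iterate_in[OF q] by blast
  have "T ` ?O = range (\<lambda>n. iterate X T (1 + n) q)"
    by (simp add: image_image T_iterate[OF q])
  also have "\<dots> = ?O"
  proof (intro equalityI subsetI)
    fix r assume "r \<in> ?O"
    then obtain n where "r = iterate X T n q" by blast
    then have "r = iterate X T (1 + (n - 1)) q" by simp
    then show "r \<in> range (\<lambda>n. iterate X T (1 + n) q)" by blast
  qed blast
  finally have "T ` (X closure_of ?O) = X closure_of ?O"
    using homeomorphic_map_closure_of[OF homeomorphic_T sub] by simp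
  moreover have "q \<in> X closure_of ?O"
    using closure_of_subset[OF sub] iterate_0[OF q] by (metis rangeI subsetD)
  ultimately show ?thesis using minimal[OF closedin_closure_of] by blast
qed

text \<open>A periodic orbit would be a finite closed invariant set, hence the whole space.\<close>

lemma inj_orbit: "inj (\<lambda>n. iterate X T n p)"
proof (rule ccontr)
  assume "\<not> inj (\<lambda>n. iterate X T n p)"
  then obtain m n where mn: "m < n" "iterate X T m p = iterate X T n p"
    unfolding inj_def by (metis linorder_neqE)
  define d where "d = n - m"
  have "iterate X T (- m) (iterate X T n p) = p"
    unfolding mn(2)[symmetric] using iterate_add[OF base] iterate_0[OF base] by simp
  then have d: "d > 0" "iterate X T d p = p"
    using iterate_add[OF base, of "- m" n] mn(1) unfolding d_def by simp_all
  define F where "F = (\<lambda>i. iterate X T i p) ` {0..<d}"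
  have F: "F \<subseteq> topspace X" "finite F" unfolding F_def using iterate_in[OF base] by auto
  have "T ` F \<subseteq> F"
  proof
    fix r assume "r \<in> T ` F"
    then obtain i where i: "0 \<le> i" "i < d" "r = iterate X T (1 + i) p"
      unfolding F_def using T_iterate[OF base] by auto
    show "r \<in> F"
    proof (cases "1 + i = d")
      case True
      then have "r = iterate X T 0 p" using i(3) d iterate_0[OF base] by simp
      then show ?thesis unfolding F_def using d(1) by auto
    next
      case False
      then show ?thesis unfolding F_def using i by auto
    qed
  qed
  moreover have "inj_on T F"
    using homeomorphic_imp_injective_map[OF homeomorphic_T] F(1) by (rule inj_on_subset)
  ultimately have "T ` F = F" by (rule endo_inj_surj[OF F(2)])
  moreover have "closedin X F" by (rule closedin_Hausdorff_finite[OF Hausdorff F])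
  ultimately have "F = {} \<or> F = topspace X" by (intro minimal)
  moreover have "F \<noteq> {}" unfolding F_def using d(1) by auto
  ultimately show False using F(2) infinite_space by simp
qed

text \<open>Every orbit meets \<open>V\<close> because it is dense, and by compactness the time it needs to reach
  \<open>V\<close> is bounded independently of the starting point. Applied to all points of the orbit of \<open>p\<close>,
  this bounds the gaps between the visits of \<open>p\<close> to \<open>V\<close>.\<close>

lemma orbit_returns:
  assumes V: "openin X V" "p \<in> V"
  shows "\<exists>R. \<forall>j. \<exists>n. \<bar>n - j\<bar> \<le> R \<and> iterate X T n p \<in> V"
proof -
  define U where "U i = {q \<in> topspace X. iterate X T i q \<in> V}" for i
  have U_open: "openin X (U i)" for i
    unfolding U_def by (rule openin_continuous_map_preimage[OF continuous_iterate V(1)])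
  have "\<exists>i. q \<in> U i" if q: "q \<in> topspace X" for q
  proof -
    have "V \<inter> X closure_of range (\<lambda>n. iterate X T n q) \<noteq> {}"
      unfolding dense_orbit[OF q] using V openin_subset by fastforce
    then have "V \<inter> range (\<lambda>n. iterate X T n q) \<noteq> {}"
      using openin_Int_closure_of_eq_empty[OF V(1)] by blast
    then show ?thesis unfolding U_def using q by auto
  qed
  then have "topspace X \<subseteq> \<Union>(range U)" by blast
  moreover have "\<forall>W\<in>range U. openin X W" using U_open by blast
  ultimately obtain \<F> where \<F>: "finite \<F>" "\<F> \<subseteq> range U" "topspace X \<subseteq> \<Union>\<F>"
    using compact unfolding compact_space_alt by meson
  obtain I where I: "finite I" "\<F> = U ` I"
    using finite_subset_image[OF \<F>(1,2)] by blast
  define R where "R = Max (insert 0 (abs ` I))"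
  have R: "\<bar>i\<bar> \<le> R" if "i \<in> I" for i
    unfolding R_def using I(1) that by auto
  have "\<exists>n. \<bar>n - j\<bar> \<le> R \<and> iterate X T n p \<in> V" for j
  proof -
    obtain i where i: "i \<in> I" "iterate X T j p \<in> U i"
      using \<F>(3) I(2) iterate_in[OF base, of j] by blast
    then have "iterate X T (i + j) p \<in> V"
      using iterate_add[OF base, of i j] unfolding U_def by simp
    then show ?thesis using R[OF i(1)] by (intro exI[of _ "i + j"]) simp
  qed
  then show ?thesis by blast
qed

text \<open>Identifying \<open>n\<close> with the point \<open>T\<^bsup>n\<^esup> p\<close>, every element of the full group permutes the
  integers.\<close>

definition orbit_action :: "('a \<Rightarrow> 'a) \<Rightarrow> int \<Rightarrow> int" where
  "orbit_action g j = inv_into UNIV (\<lambda>n. iterate X T n p) (g (iterate X T j p))"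

lemma orbit_action_eqI: "g (iterate X T j p) = iterate X T n p \<Longrightarrow> orbit_action g j = n"
  unfolding orbit_action_def using inv_f_f[OF inj_orbit] by simp

lemma orbit_action_cocycle:
  assumes "cocycle g \<kappa>"
  shows "orbit_action g j = \<kappa> (iterate X T j p) + j"
  using assms iterate_in[OF base, of j] iterate_add[OF base]
  unfolding cocycle_def by (intro orbit_action_eqI) simp

lemma orbit_action_apply:
  assumes "g \<in> carrier (topological_full_group X T)"
  shows "g (iterate X T j p) = iterate X T (orbit_action g j) p"
proof -
  obtain \<kappa> where \<kappa>: "cocycle g \<kappa>" using assms full_group_iff_cocycle by blast
  then have "g (iterate X T j p) = iterate X T (\<kappa> (iterate X T j p)) (iterate X T j p)"
    using iterate_in[OF base] unfolding cocycle_def by blast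
  then show ?thesis
    using iterate_add[OF base] orbit_action_cocycle[OF \<kappa>] by simp
qed

text \<open>The action on the orbit is faithful because the orbit is dense. Displacements are bounded
  because cocycles have finite range. For recurrence, the points \<open>q\<close> around which finitely many
  cocycles show the same values along a finite orbit segment as around \<open>p\<close> form an open
  neighbourhood of \<open>p\<close>, to which \<open>p\<close> returns with bounded gaps.\<close>

sublocale recurrent_displacement_action "topological_full_group X T" orbit_action
proof (intro recurrent_displacement_action.intro recurrent_displacement_action_axioms.intro)
  let ?G = "topological_full_group X T"
  have H: "g \<in> carrier (homeo_group X)" if "g \<in> carrier ?G" for g
    using that full_group_iff_cocycle by blast
  show "group ?G" by (rule group_full_group)
  show "orbit_action \<one>\<^bsub>?G\<^esub> j = j" for j
    using iterate_in[OF base] by (intro orbit_action_eqI) (simp add: full_group_one homeo_group_one_apply)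
  show "orbit_action (g \<otimes>\<^bsub>?G\<^esub> h) j = orbit_action g (orbit_action h j)"
    if "g \<in> carrier ?G" "h \<in> carrier ?G" for g h j
    using iterate_in[OF base] that
    by (intro orbit_action_eqI)
      (simp add: full_group_mult homeo_group_mult_apply H orbit_action_apply)
  show "inj_on orbit_action (carrier ?G)"
  proof (rule inj_onI)
    fix g h assume gh: "g \<in> carrier ?G" "h \<in> carrier ?G" "orbit_action g = orbit_action h"
    have agree: "g r = h r" if r: "r \<in> range (\<lambda>n. iterate X T n p)" for r
    proof -
      obtain n where "r = iterate X T n p" using r by blast
      then show ?thesis
        by (simp only: orbit_action_apply[OF gh(1)] orbit_action_apply[OF gh(2)] gh(3))
    qed
    have cont: "continuous_map X X g" "continuous_map X X h"
      using carrier_homeo_groupD(1)[OF H] gh homeomorphic_imp_continuous_map by blast+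
    have "g q = h q" if "q \<in> topspace X" for q
      using forall_in_closure_of_eq[OF _ Hausdorff cont agree] that dense_orbit[OF base] by blast
    then show "g = h"
      using carrier_homeo_groupD(2)[OF H] gh by (intro extensionalityI[of g "topspace X" h]) auto
  qed
  show "\<exists>k. \<forall>j. \<bar>orbit_action g j - j\<bar> \<le> k" if g: "g \<in> carrier ?G" for g
  proof -
    obtain \<kappa> where \<kappa>: "cocycle g \<kappa>" using g full_group_iff_cocycle by blast
    then have "finite (\<kappa> ` topspace X)" unfolding cocycle_def by blast
    then have "\<bar>orbit_action g j - j\<bar> \<le> Max (abs ` \<kappa> ` topspace X)" for j
      unfolding orbit_action_cocycle[OF \<kappa>] using iterate_in[OF base, of j] by (intro Max_ge) auto
    then show ?thesis by blast
  qed
  fix S L assume S: "finite S" "S \<subseteq> carrier ?G"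
  have "\<exists>\<kappa>. cocycle s \<kappa>" if "s \<in> S" for s
    using that S(2) full_group_iff_cocycle by blast
  then obtain \<kappa> where \<kappa>: "\<And>s. s \<in> S \<Longrightarrow> cocycle s (\<kappa> s)" by metis
  define W where "W = (\<lambda>(s, i). {q \<in> topspace X. iterate X T i q \<in>
    {r \<in> topspace X. \<kappa> s r = \<kappa> s (iterate X T i p)}})"
  define V where "V = (\<Inter>x\<in>S \<times> {- L..L}. W x) \<inter> topspace X"
  have "openin X (W (s, i))" if "s \<in> S" for s i
  proof -
    have "openin X {r \<in> topspace X. \<kappa> s r = \<kappa> s (iterate X T i p)}"
      using \<kappa>[OF that] unfolding cocycle_def by blast
    then show ?thesis
      unfolding W_def prod.case by (rule openin_continuous_map_preimage[OF continuous_iterate])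
  qed
  then have "openin X V"
    unfolding V_def using S(1) by (intro openin_INT) auto
  moreover have "p \<in> V"
    unfolding V_def W_def using base iterate_in[OF base] by auto
  ultimately obtain R where R: "\<forall>j. \<exists>n. \<bar>n - j\<bar> \<le> R \<and> iterate X T n p \<in> V"
    using orbit_returns by blast
  have "orbit_action s (n + i) = n + orbit_action s i"
    if n: "iterate X T n p \<in> V" and s: "s \<in> S" and i: "\<bar>i\<bar> \<le> L" for n s i
  proof -
    have "(s, i) \<in> S \<times> {- L..L}" using s i by auto
    then have "iterate X T n p \<in> W (s, i)" using n unfolding V_def by blast
    then have "\<kappa> s (iterate X T (n + i) p) = \<kappa> s (iterate X T i p)"
      using iterate_add[OF base, of i n] unfolding W_def by (simp add: add.commute)
    then show ?thesis unfolding orbit_action_cocycle[OF \<kappa>[OF s]] by simp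
  qed
  with R show "\<exists>R. \<forall>j. \<exists>n. \<bar>n - j\<bar> \<le> R \<and>
      (\<forall>s\<in>S. \<forall>i. \<bar>i\<bar> \<le> L \<longrightarrow> orbit_action s (n + i) = n + orbit_action s i)"
    by meson
qed

end

theorem amenable_full_group_if_minimal:
  assumes "compact_space X" "Hausdorff_space X" "infinite (topspace X)" "minimal_homeomorphism X T"
  shows "amenable_group (topological_full_group X T)"
proof -
  obtain p where "p \<in> topspace X" using assms(3) by (metis finite.emptyI equals0I)
  then interpret minimal_system X T p
    using assms unfolding minimal_homeomorphism_def by unfold_locales auto
  show ?thesis by (rule amenable)
qed

lemma cantor_space_compact_Hausdorff_infinite:
  assumes "cantor_space X"
  shows "compact_space X" "Hausdorff_space X" "infinite (topspace X)"
proof -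
  let ?K = "product_topology (\<lambda>_::nat. discrete_topology (UNIV :: bool set)) UNIV"
  have hom: "X homeomorphic_space ?K" using assms unfolding cantor_space_def .
  show "compact_space X"
    unfolding homeomorphic_compact_space[OF hom]
    by (simp add: compact_space_product_topology compact_space_discrete_topology)
  show "Hausdorff_space X"
    unfolding homeomorphic_Hausdorff_space[OF hom]
    by (simp add: Hausdorff_space_product_topology)
  obtain f where "homeomorphic_map X ?K f"
    using hom unfolding homeomorphic_space by blast
  then have "f ` topspace X = UNIV"
    using homeomorphic_imp_surjective_map by fastforce
  moreover have "infinite (UNIV :: (nat \<Rightarrow> bool) set)"
    using finite_fun_UNIVD1[where 'a = nat and 'b = bool] by auto
  ultimately show "infinite (topspace X)" by (metis finite_imageI)
qed

theorem theorem1: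
  fixes C :: "'a topology" and T :: "'a \<Rightarrow> 'a"
  assumes "cantor_space C"
    and "minimal_homeomorphism C T"
  shows "amenable_group (topological_full_group C T)"
  using amenable_full_group_if_minimal[OF cantor_space_compact_Hausdorff_infinite[OF assms(1)] assms(2)] .

end
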